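(* Let $\mathbb{H}=\mathbb{R}$ or $\mathbb{C}$ and $d\ge 2$, and consider Borel probability measures on $G(1,d)$. (1) If $0<s<1$, then the invariant measure $\Gamma_{1,d}$ is the unique minimizer of $F_{\alpha_s}(\mu)=\sup_{x\in\mathbb{S}^{d-1}}\int_{G(1,d)}(1-\|P_W(x)\|^2)^s\,d\mu(W)$ over all Borel probability measures $\mu$ on $G(1,d)$. (2) The invariant measure $\Gamma_{1,d}$ is the unique minimizer of $F_{\alpha_{\log}}(\mu)=\sup_{x\in\mathbb{S}^{d-1}}\int_{G(1,d)}\log(1-\|P_W(x)\|^2)\,d\mu(W)$ over all Borel probability measures $\mu$ on $G(1,d)$.
   Context: $G(1,d)$ is the set of one-dimensional subspaces of $\mathbb{H}^d$, with metric $d(V,W)=\|P_V-P_W\|_{\mathrm{Frob}}$, where $P_V$ is the orthogonal projection onto $V$; $\mathbb{S}^{d-1}$ is the unit sphere of $\mathbb{H}^d$. $\Gamma_{1,d}$ is the unique Borel probability measure on $G(1,d)$ invariant under the orthogonal group (if $\mathbb{H}=\mathbb{R}$) or unitary group (if $\mathbb{H}=\mathbb{C}$). *)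

theory Defs
  imports "HOL-Probability.Probability"
begin

text \<open>H^d is modelled as 'f^'n with 'f = real (conjugation cj = id) or
 'f = complex (conjugation cj = cnj); d = CARD('n).
 A line W is represented by its orthogonal projection matrix P_W = v v^*,
 v a unit vector; G(1,d) is the set of these matrices, a subspace of the
 matrix space with the Frobenius norm (the norm of 'f^'n^'n).\<close>

definition proj_line :: "('f::real_normed_field \<Rightarrow> 'f) \<Rightarrow> 'f^'n \<Rightarrow> 'f^'n^'n" where
  "proj_line cj v = (\<chi> i j. v$i * cj (v$j))"

definition Grass1 :: "('f::real_normed_field \<Rightarrow> 'f) \<Rightarrow> ('f^'n^'n) set" where
  "Grass1 cj = {P. \<exists>v. norm v = 1 \<and> P = proj_line cj v}"

definition sphere_H :: "(('f::real_normed_field)^'n) set" where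
  "sphere_H = {x. norm x = 1}"

definition adj :: "('f::real_normed_field \<Rightarrow> 'f) \<Rightarrow> 'f^'n^'n \<Rightarrow> 'f^'n^'n" where
  "adj cj U = (\<chi> i j. cj (U$j$i))"

definition unitary_mat :: "('f::real_normed_field \<Rightarrow> 'f) \<Rightarrow> 'f^'n^'n \<Rightarrow> bool" where
  "unitary_mat cj U \<longleftrightarrow> adj cj U ** U = mat 1"

definition borel_prob_G :: "('f::real_normed_field \<Rightarrow> 'f) \<Rightarrow> ('f^'n^'n) measure \<Rightarrow> bool" where
  "borel_prob_G cj \<mu> \<longleftrightarrow> prob_space \<mu> \<and> sets \<mu> = sets (restrict_space borel (Grass1 cj))"

text \<open>Borel probability measure on G(1,d) invariant under the group action W \<mapsto> U W\<close>
definition invariant_G :: "('f::real_normed_field \<Rightarrow> 'f) \<Rightarrow> ('f^'n^'n) measure \<Rightarrow> bool" where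
  "invariant_G cj \<Gamma> \<longleftrightarrow> borel_prob_G cj \<Gamma> \<and>
     (\<forall>U. unitary_mat cj U \<longrightarrow> distr \<Gamma> \<Gamma> (\<lambda>P. U ** P ** adj cj U) = \<Gamma>)"

definition F_pow :: "real \<Rightarrow> ('f::real_normed_field^'n^'n) measure \<Rightarrow> real" where
  "F_pow s \<mu> = (SUP x\<in>sphere_H. \<integral>W. (1 - (norm (W *v x))\<^sup>2) powr s \<partial>\<mu>)"

definition neglog1m :: "real \<Rightarrow> ennreal" where
  "neglog1m t = (if t \<ge> 1 then \<infinity> else ennreal (- ln (1 - t)))"

text \<open>F_log(\<mu>) = sup_x \<integral> log(1 - |P_W x|^2) d\<mu>(W), valued in [-\<infinity>,0]\<close>
definition F_log :: "('f::real_normed_field^'n^'n) measure \<Rightarrow> ereal" where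
  "F_log \<mu> = (SUP x\<in>sphere_H. - enn2ereal (\<integral>\<^sup>+W. neglog1m ((norm (W *v x))\<^sup>2) \<partial>\<mu>))"

definition unique_minimizer :: "('f::real_normed_field \<Rightarrow> 'f) \<Rightarrow> (('f^'n^'n) measure \<Rightarrow> 'b::order)
     \<Rightarrow> ('f^'n^'n) measure \<Rightarrow> bool" where
  "unique_minimizer cj F \<Gamma> \<longleftrightarrow> borel_prob_G cj \<Gamma> \<and>
     (\<forall>\<mu>. borel_prob_G cj \<mu> \<longrightarrow> F \<Gamma> \<le> F \<mu> \<and> (F \<mu> \<le> F \<Gamma> \<longrightarrow> \<mu> = \<Gamma>))"

end

theory Submission
  imports Defs
begin

text \<open>Identify a line with its projection in the real Euclidean space of matrices; then
  \<open>|P_W x|^2\<close> is the inner product of \<open>P_W\<close> and \<open>P_x\<close>. The kernels \<open>1 - (1 - t)^s\<close> and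
  \<open>- ln (1 - t)\<close> are power series \<open>\<Sum> a_k t^k\<close> with \<open>a_k > 0\<close> for \<open>k \<ge> 1\<close>. The invariant measure
  \<open>\<Gamma>\<close> has a constant potential \<open>C\<close>; it is finite in the logarithmic case because balls of
  radius \<open>r\<close> have \<open>\<Gamma>\<close>-measure \<open>O(r)\<close> by packing. If \<open>\<mu>\<close> does at least as well as \<open>\<Gamma>\<close>, its potential
  is everywhere at least \<open>C\<close>, with \<open>\<Gamma>\<close>-mean \<open>C\<close>, hence equal to \<open>C\<close> almost everywhere; by full
  support of \<open>\<Gamma>\<close> the energy of \<open>\<mu>\<close> is at most that of \<open>\<Gamma>\<close>. The degree \<open>k\<close> part of the energy
  difference is \<open>a_k\<close> times the sum of the squared differences of the degree \<open>k\<close> monomial moments, so all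
  moments agree, and \<open>\<mu> = \<Gamma>\<close> by the Stone--Weierstrass theorem.\<close>

section \<open>Measures determined by their moments\<close>

text \<open>Closed sets are an intersection-stable generator of the Borel sets. The indicator of a
  closed set is the pointwise limit of tent functions of the distance to it, so dominated
  convergence carries equality of integrals over to closed sets.\<close>

lemma measure_eqI_continuous:
  fixes M N :: "'a::metric_space measure"
  assumes M: "finite_measure M" "sets M = sets borel" and N: "finite_measure N" "sets N = sets borel"
    and eq: "\<And>f :: 'a \<Rightarrow> real. continuous_on UNIV f \<Longrightarrow> (\<And>x. 0 \<le> f x \<and> f x \<le> 1) \<Longrightarrow>
               integral\<^sup>L M f = integral\<^sup>L N f"
  shows "M = N"
proof -
  interpret M: finite_measure M by fact
  interpret N: finite_measure N by fact
  note [measurable_cong] = M(2) N(2)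
  have sp: "space M = UNIV" "space N = UNIV"
    using sets_eq_imp_space_eq[OF M(2)] sets_eq_imp_space_eq[OF N(2)] by simp_all
  \<comment> \<open>For empty \<open>C\<close> the value of \<open>infdist\<close> is 0 everywhere
    and the tent functions would be constantly 1, so this case is split off.\<close>
  have closed_eq: "emeasure M C = emeasure N C" if C: "closed C" for C
  proof (cases "C = {}")
    case False
    define f where "f n x = max 0 (1 - real n * infdist x C)" for n x
    have cont: "continuous_on UNIV (f n)" for n
      unfolding f_def by (intro continuous_intros)
    then have meas [measurable]: "f n \<in> borel_measurable borel" for n
      by (rule borel_measurable_continuous_onI)
    have [measurable]: "C \<in> sets borel" using C by simp
    have bd: "0 \<le> f n x \<and> f n x \<le> 1" for n x
      unfolding f_def using infdist_nonneg[of x C] by auto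
    have lim: "(\<lambda>n. f n x) \<longlonglongrightarrow> indicator C x" for x
    proof (cases "x \<in> C")
      case True
      then show ?thesis by (simp add: f_def)
    next
      case xC: False
      have pos: "infdist x C > 0"
        using infdist_pos_not_in_closed[OF C False xC] .
      obtain n0 where n0: "1 < real n0 * infdist x C"
        using reals_Archimedean3[OF pos] by blast
      have "f n x = 0" if "n \<ge> n0" for n
      proof -
        have "real n0 * infdist x C \<le> real n * infdist x C"
          using that pos by (simp add: mult_right_mono)
        then show ?thesis using n0 by (simp add: f_def)
      qed
      then have "eventually (\<lambda>n. f n x = indicator C x) sequentially"
        using xC by (auto simp: eventually_sequentially)
      then show ?thesis by (rule tendsto_eventually)
    qed
    have "(\<lambda>n. integral\<^sup>L M (f n)) \<longlonglongrightarrow> integral\<^sup>L M (indicator C)"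
      by (rule integral_dominated_convergence[where w="\<lambda>_. 1"]) (use lim bd in auto)
    moreover have "(\<lambda>n. integral\<^sup>L N (f n)) \<longlonglongrightarrow> integral\<^sup>L N (indicator C)"
      by (rule integral_dominated_convergence[where w="\<lambda>_. 1"]) (use lim bd in auto)
    moreover have "integral\<^sup>L M (f n) = integral\<^sup>L N (f n)" for n
      by (rule eq[OF cont bd])
    ultimately have "integral\<^sup>L M (indicator C) = (integral\<^sup>L N (indicator C) :: real)"
      using LIMSEQ_unique by simp
    then have "measure M C = measure N C" by (simp add: sp)
    then show ?thesis
      by (simp add: M.emeasure_eq_measure N.emeasure_eq_measure)
  qed simp
  show ?thesis
  proof (rule measure_eqI_generator_eq[where E="Collect closed" and \<Omega>=UNIV and A="\<lambda>_. UNIV"])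
    show "Int_stable (Collect (closed :: 'a set \<Rightarrow> bool))" by (auto simp: Int_stable_def)
    show "sets M = sigma_sets UNIV (Collect closed)" "sets N = sigma_sets UNIV (Collect closed)"
      by (simp_all add: M(2) N(2) borel_eq_closed)
  qed (auto simp: closed_eq)
qed

text \<open>With basis lists as \<open>bs\<close>, these are the coordinates of a tensor power of
  \<open>x\<close>. Ordered lists with repetition, instead of multi-indices, keep multinomial
  coefficients out of the expansion of \<open>(x \<bullet> y) ^ k\<close>.\<close>

definition inner_monom :: "'a::real_inner list \<Rightarrow> 'a \<Rightarrow> real" where
  "inner_monom bs x = (\<Prod>b\<leftarrow>bs. x \<bullet> b)"

lemma continuous_on_inner_monom: "continuous_on A (inner_monom bs)"
proof -
  have "continuous_on A (\<lambda>x. \<Prod>b\<leftarrow>bs. x \<bullet> b)"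
    by (induction bs) (auto intro!: continuous_intros)
  then show ?thesis by (simp add: inner_monom_def[abs_def])
qed

text \<open>This is the inner product of the \<open>k\<close>-fold tensor powers of \<open>x\<close>
  and \<open>y\<close>. In the induction one more factor \<open>x \<bullet> y\<close> is expanded in
  coordinates, and its basis vector is put in front of the list.\<close>

lemma inner_power_eq_sum_monom:
  fixes x y :: "'a::euclidean_space"
  shows "(x \<bullet> y) ^ k =
    (\<Sum>bs | set bs \<subseteq> Basis \<and> length bs = k. inner_monom bs x * inner_monom bs y)"
proof (induction k)
  case 0
  have "{bs :: 'a list. set bs \<subseteq> Basis \<and> length bs = 0} = {[]}" by auto
  then show ?case by (simp add: inner_monom_def)
next
  case (Suc k)
  let ?S = "{bs :: 'a list. set bs \<subseteq> Basis \<and> length bs = k}"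
  have "(x \<bullet> y) ^ Suc k = (\<Sum>b\<in>Basis. (x \<bullet> b) * (y \<bullet> b)) * (\<Sum>bs\<in>?S. inner_monom bs x * inner_monom bs y)"
    using Suc by (simp add: euclidean_inner[of x y])
  also have "\<dots> = (\<Sum>(b, bs)\<in>Basis \<times> ?S. inner_monom (b # bs) x * inner_monom (b # bs) y)"
    by (simp add: sum_product sum.cartesian_product inner_monom_def mult_ac)
  also have "\<dots> = (\<Sum>bs\<in>(\<lambda>(b, bs). b # bs) ` (Basis \<times> ?S). inner_monom bs x * inner_monom bs y)"
    by (subst sum.reindex) (auto simp: inj_on_def case_prod_unfold)
  also have "(\<lambda>(b, bs). b # bs) ` (Basis \<times> ?S) = {bs :: 'a list. set bs \<subseteq> Basis \<and> length bs = Suc k}"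
    by (auto simp: image_iff length_Suc_conv)
  finally show ?case .
qed

text \<open>The measure lives on the whole Euclidean space and is concentrated on \<open>G\<close>
  almost everywhere. All measures thus share one sigma-algebra, and continuous functions are
  essentially bounded.\<close>

locale compactly_supported_prob = prob_space M for M :: "'a::euclidean_space measure" +
  fixes G :: "'a set"
  assumes sets_M [simp, measurable_cong]: "sets M = sets borel"
    and compact_G: "compact G"
    and AE_G: "AE x in M. x \<in> G"
begin

lemma integrable_continuous:
  fixes f :: "'a \<Rightarrow> real"
  assumes "continuous_on UNIV f"
  shows "integrable M f"
proof -
  have "compact (f ` G)"
    using compact_G assms by (meson compact_continuous_image continuous_on_subset subset_UNIV)
  then obtain B where B: "\<And>y. y \<in> f ` G \<Longrightarrow> norm y \<le> B"
    using compact_imp_bounded bounded_iff by metis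
  have "f \<in> borel_measurable M"
    using borel_measurable_continuous_onI[OF assms] by simp
  then show ?thesis
    using AE_G B by (intro integrable_const_bound[of _ B]) auto
qed

lemma integrable_inner_monom: "integrable M (inner_monom bs)"
  by (rule integrable_continuous) (rule continuous_on_inner_monom)

lemma integral_inner_power:
  "(\<integral>x. (x \<bullet> y) ^ k \<partial>M) =
    (\<Sum>bs | set bs \<subseteq> Basis \<and> length bs = k. (\<integral>x. inner_monom bs x \<partial>M) * inner_monom bs y)"
  by (simp add: inner_power_eq_sum_monom integrable_inner_monom)

end

text \<open>Equal monomial moments give equal integrals of polynomials, which approximate continuous
  functions uniformly on the compact set \<open>G\<close>; continuous functions in turn determine
  the measure.\<close>

lemma measure_eqI_inner_monom:
  fixes M N :: "'a::euclidean_space measure"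
  assumes "compactly_supported_prob M G" "compactly_supported_prob N G"
    and eq: "\<And>bs. set bs \<subseteq> Basis \<Longrightarrow> (\<integral>x. inner_monom bs x \<partial>M) = (\<integral>x. inner_monom bs x \<partial>N)"
  shows "M = N"
proof -
  interpret M: compactly_supported_prob M G by fact
  interpret N: compactly_supported_prob N G by fact
  \<comment> \<open>Testing \<open>q\<close> against every monomial, and not only against 1, makes
    \<open>V\<close> stable under multiplication by a coordinate: the coordinate is absorbed into
    the monomial.\<close>
  define V where "V = {q :: 'a \<Rightarrow> real. continuous_on UNIV q \<and>
    (\<forall>bs. set bs \<subseteq> Basis \<longrightarrow> (\<integral>x. inner_monom bs x * q x \<partial>M) = (\<integral>x. inner_monom bs x * q x \<partial>N))}"
  have int: "integrable M (\<lambda>x. inner_monom bs x * q x)" "integrable N (\<lambda>x. inner_monom bs x * q x)"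
    if "continuous_on UNIV q" for bs q
    using that by (auto intro!: M.integrable_continuous N.integrable_continuous continuous_intros continuous_on_inner_monom)
  have V_I: "q \<in> V" if "continuous_on UNIV q"
    "\<And>bs. set bs \<subseteq> Basis \<Longrightarrow> (\<integral>x. inner_monom bs x * q x \<partial>M) = (\<integral>x. inner_monom bs x * q x \<partial>N)" for q
    using that by (simp add: V_def)
  have V_cont: "continuous_on UNIV q" if "q \<in> V" for q
    using that by (simp add: V_def)
  have V_eq: "(\<integral>x. inner_monom bs x * q x \<partial>M) = (\<integral>x. inner_monom bs x * q x \<partial>N)"
    if "q \<in> V" "set bs \<subseteq> Basis" for q bs
    using that by (simp add: V_def)
  have one: "(\<lambda>_. 1) \<in> V"
    by (rule V_I) (simp_all add: eq)
  have add: "(\<lambda>x. p x + q x) \<in> V" if "p \<in> V" "q \<in> V" for p q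
    by (rule V_I) (simp_all add: that V_cont V_eq distrib_left int continuous_on_add)
  have scale: "(\<lambda>x. c * p x) \<in> V" if "p \<in> V" for p c
    by (rule V_I) (simp_all add: that V_cont V_eq mult.left_commute[of _ c] continuous_on_mult_left)
  have coord: "(\<lambda>x. (x \<bullet> b) * p x) \<in> V" if "p \<in> V" "b \<in> Basis" for p b
  proof (rule V_I)
    show "continuous_on UNIV (\<lambda>x. (x \<bullet> b) * p x)"
      by (intro continuous_intros V_cont that)
    fix bs :: "'a list" assume "set bs \<subseteq> Basis"
    then have "(\<integral>x. inner_monom (b # bs) x * p x \<partial>M) = (\<integral>x. inner_monom (b # bs) x * p x \<partial>N)"
      using that by (intro V_eq) simp_all
    then show "(\<integral>x. inner_monom bs x * ((x \<bullet> b) * p x) \<partial>M) = (\<integral>x. inner_monom bs x * ((x \<bullet> b) * p x) \<partial>N)"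
      by (simp add: inner_monom_def mult_ac)
  qed
  have zero: "(\<lambda>_. 0) \<in> V" using scale[OF one, of 0] by simp
  have sum: "(\<lambda>x. \<Sum>b\<in>B. f b x) \<in> V" if "finite B" "\<And>b. b \<in> B \<Longrightarrow> f b \<in> V" for B and f :: "'a \<Rightarrow> 'a \<Rightarrow> real"
    using that by (induction B rule: finite_induct) (simp_all add: zero add)
  \<comment> \<open>The factor \<open>q\<close> is arbitrary in the induction, so a product of
    polynomials is handled one factor at a time. The choice \<open>q = 1\<close> then puts every
    polynomial into \<open>V\<close>.\<close>
  have poly_mult: "(\<lambda>x. p x * q x) \<in> V" if "real_polynomial_function p" "q \<in> V" for p q
    using that
  proof (induction p arbitrary: q rule: real_polynomial_function.induct)
    case (linear f)
    interpret f: bounded_linear f by fact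
    have f_eq: "f x = (\<Sum>b\<in>Basis. (x \<bullet> b) * f b)" for x
    proof -
      have "f x = f (\<Sum>b\<in>Basis. (x \<bullet> b) *\<^sub>R b)" by (simp add: euclidean_representation)
      also have "\<dots> = (\<Sum>b\<in>Basis. (x \<bullet> b) * f b)" by (simp add: f.sum f.scaleR)
      finally show ?thesis .
    qed
    have "(\<lambda>x. f x * q x) = (\<lambda>x. \<Sum>b\<in>Basis. (x \<bullet> b) * (f b * q x))"
      by (rule ext, subst f_eq) (simp add: sum_distrib_right mult.assoc)
    then show ?case using linear by (simp add: sum coord scale)
  next
    case (mult f g)
    then show ?case by (simp add: mult.assoc)
  qed (simp_all add: scale distrib_right add)
  show ?thesis
  proof (rule measure_eqI_continuous)
    fix f :: "'a \<Rightarrow> real" assume f: "continuous_on UNIV f"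
    have small: "\<bar>integral\<^sup>L M f - integral\<^sup>L N f\<bar> \<le> e" if "e > 0" for e :: real
    proof -
      have "continuous_on G f" using f continuous_on_subset by blast
      then obtain g where g: "real_polynomial_function g" "\<And>x. x \<in> G \<Longrightarrow> \<bar>f x - g x\<bar> < e / 2"
        using Stone_Weierstrass_real_polynomial_function[OF M.compact_G, of f "e / 2"] \<open>e > 0\<close> by auto
      have gV: "g \<in> V" using poly_mult[OF g(1) one] by simp
      then have gc: "continuous_on UNIV g" by (rule V_cont)
      have "(\<integral>x. inner_monom [] x * g x \<partial>M) = (\<integral>x. inner_monom [] x * g x \<partial>N)"
        using gV by (rule V_eq) simp
      then have geq: "integral\<^sup>L M g = integral\<^sup>L N g" by (simp add: inner_monom_def)
      have close: "\<bar>integral\<^sup>L A f - integral\<^sup>L A g\<bar> \<le> e / 2" if "compactly_supported_prob A G" for A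
      proof -
        interpret A: compactly_supported_prob A G by fact
        have i: "integrable A f" "integrable A g" using f gc A.integrable_continuous by auto
        have "\<bar>integral\<^sup>L A f - integral\<^sup>L A g\<bar> = \<bar>\<integral>x. f x - g x \<partial>A\<bar>" using i by simp
        also have "\<dots> \<le> (\<integral>x. \<bar>f x - g x\<bar> \<partial>A)" by (rule integral_abs_bound)
        also have "\<dots> \<le> (\<integral>x. e / 2 \<partial>A)"
          using A.AE_G g(2) i by (intro integral_mono_AE) (auto elim!: eventually_mono simp: less_imp_le)
        finally show ?thesis by (simp add: A.prob_space)
      qed
      show ?thesis using close[OF assms(1)] close[OF assms(2)] unfolding geq by linarith
    qed
    have "\<bar>integral\<^sup>L M f - integral\<^sup>L N f\<bar> \<le> 0"
      by (rule field_le_epsilon) (simp add: small)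
    then show "integral\<^sup>L M f = integral\<^sup>L N f" by simp
  qed (simp_all add: M.finite_measure_axioms N.finite_measure_axioms)
qed

section \<open>Energies of isotropic measures\<close>

definition monom_integral :: "'a::euclidean_space measure \<Rightarrow> 'a list \<Rightarrow> real" where
  "monom_integral M bs = (\<integral>x. inner_monom bs x \<partial>M)"

definition moment :: "'a::euclidean_space measure \<Rightarrow> nat \<Rightarrow> 'a \<Rightarrow> real" where
  "moment M k Q = (\<integral>P. (P \<bullet> Q) ^ k \<partial>M)"

definition mutual_moment :: "'a::euclidean_space measure \<Rightarrow> 'a measure \<Rightarrow> nat \<Rightarrow> real" where
  "mutual_moment M N k = (\<integral>Q. moment M k Q \<partial>N)"

text \<open>The values are in \<open>ennreal\<close> because the logarithmic kernel is infinite
  where \<open>P \<bullet> Q = 1\<close>. \<open>ennreal\<close> would cut negative terms to 0, but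
  for nonnegative coefficients and nonnegative \<open>P \<bullet> Q\<close> there are none.\<close>

definition series_potential :: "(nat \<Rightarrow> real) \<Rightarrow> 'a::euclidean_space measure \<Rightarrow> 'a \<Rightarrow> ennreal" where
  "series_potential a M Q = (\<integral>\<^sup>+P. (\<Sum>k. ennreal (a k * (P \<bullet> Q) ^ k)) \<partial>M)"

context compactly_supported_prob
begin

lemma moment_eq_sum:
  "moment M k Q = (\<Sum>bs | set bs \<subseteq> Basis \<and> length bs = k. monom_integral M bs * inner_monom bs Q)"
  by (simp add: moment_def integral_inner_power monom_integral_def)

lemma continuous_on_moment: "continuous_on A (moment M k)"
  unfolding moment_eq_sum[abs_def] by (intro continuous_intros continuous_on_inner_monom)

lemma borel_measurable_moment [measurable]: "moment M k \<in> borel_measurable borel"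
  by (rule borel_measurable_continuous_onI) (rule continuous_on_moment)

end

text \<open>The energy of degree \<open>k\<close> becomes an inner product of two moment vectors.
  This shows its symmetry in \<open>M\<close> and \<open>N\<close> and later turns an energy
  difference into a sum of squares.\<close>

lemma mutual_moment_eq_sum:
  assumes "compactly_supported_prob M G" "compactly_supported_prob N G"
  shows "mutual_moment M N k =
    (\<Sum>bs | set bs \<subseteq> Basis \<and> length bs = k. monom_integral M bs * monom_integral N bs)"
proof -
  interpret M: compactly_supported_prob M G by fact
  interpret N: compactly_supported_prob N G by fact
  show ?thesis
    by (simp add: mutual_moment_def M.moment_eq_sum N.integrable_inner_monom monom_integral_def)
qed

text \<open>The last assumption is the form in which group invariance enters: the law of
  \<open>x \<bullet> P\<close> under \<open>N\<close> is the same for all \<open>P\<close> in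
  \<open>G\<close>.\<close>

locale isotropic_prob = compactly_supported_prob N G for N :: "'a::euclidean_space measure" and G +
  assumes norm_G: "P \<in> G \<Longrightarrow> norm P = 1"
    and inner_G_nonneg: "P \<in> G \<Longrightarrow> Q \<in> G \<Longrightarrow> 0 \<le> P \<bullet> Q"
    and isotropic: "P \<in> G \<Longrightarrow> Q \<in> G \<Longrightarrow> f \<in> borel_measurable borel \<Longrightarrow>
      (\<integral>\<^sup>+x. f (x \<bullet> P) \<partial>N) = (\<integral>\<^sup>+x. f (x \<bullet> Q :: real) \<partial>N)"
begin

lemma dist_sq_G: "P \<in> G \<Longrightarrow> Q \<in> G \<Longrightarrow> (dist P Q)\<^sup>2 = 2 - 2 * (P \<bullet> Q)"
  using dot_norm_neg[of P Q] norm_G[of P] norm_G[of Q] by (simp add: dist_norm field_simps)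

text \<open>Between unit vectors the distance is a function of the inner product, so up to a null
  set a ball around \<open>P\<close> is an event about \<open>x \<bullet> P\<close>, and isotropy
  applies.\<close>

lemma emeasure_ball_eq:
  assumes "P \<in> G" "Q \<in> G"
  shows "emeasure N (ball P r) = emeasure N (ball Q r)"
proof (cases "r > 0")
  case True
  define f :: "real \<Rightarrow> ennreal" where "f = indicator {t. 2 - 2 * t < r\<^sup>2}"
  have [measurable]: "f \<in> borel_measurable borel" unfolding f_def by measurable
  have *: "emeasure N (ball X r) = (\<integral>\<^sup>+x. f (x \<bullet> X) \<partial>N)" if "X \<in> G" for X
  proof -
    have "emeasure N (ball X r) = (\<integral>\<^sup>+x. indicator (ball X r) x \<partial>N)" by simp
    also have "\<dots> = (\<integral>\<^sup>+x. f (x \<bullet> X) \<partial>N)"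
    proof (rule nn_integral_cong_AE)
      show "AE x in N. indicator (ball X r) x = f (x \<bullet> X)"
        using AE_G
      proof eventually_elim
        case (elim x)
        have "dist X x < r \<longleftrightarrow> (dist X x)\<^sup>2 < r\<^sup>2"
          using True by (metis less_imp_le power2_less_imp_less power_strict_mono zero_le_dist pos2)
        then show ?case
          using dist_sq_G[OF that elim] by (simp add: f_def indicator_def inner_commute)
      qed
    qed
    finally show ?thesis .
  qed
  show ?thesis using assms by (simp add: * isotropic[of P Q f])
qed (simp add: ball_empty)

text \<open>By compactness finitely many balls of radius \<open>r\<close> with centres in
  \<open>G\<close> cover \<open>G\<close>. They all have the same measure, so if one were null,
  \<open>N\<close> would vanish.\<close>

lemma emeasure_ball_pos:
  assumes "Q \<in> G" "r > 0"
  shows "emeasure N (ball Q r) \<noteq> 0"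
proof
  assume zero: "emeasure N (ball Q r) = 0"
  have cover: "G \<subseteq> (\<Union>x\<in>G. ball x r)"
    using \<open>r > 0\<close> by auto
  obtain D where D: "D \<subseteq> G" "finite D" "G \<subseteq> (\<Union>x\<in>D. ball x r)"
    by (rule compactE_image[OF compact_G _ cover]) auto
  have "emeasure N (\<Union>x\<in>D. ball x r) \<le> (\<Sum>x\<in>D. emeasure N (ball x r))"
    by (rule emeasure_subadditive_finite) (use D in auto)
  also have "\<dots> = 0"
    using D emeasure_ball_eq[OF _ assms(1), of _ r] zero by (intro sum.neutral) auto
  finally have "emeasure N (\<Union>x\<in>D. ball x r) = 0" by simp
  then have "AE x in N. x \<notin> (\<Union>x\<in>D. ball x r)"
    by (intro AE_not_in null_setsI) (simp_all add: borel_open open_UN)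
  then have "AE x in N. False"
    using AE_G by eventually_elim (use D in auto)
  then show False by simp
qed

text \<open>Full support of \<open>N\<close>: a violation at \<open>Q\<close> persists on a ball
  around \<open>Q\<close> by continuity, and that ball is not null.\<close>

lemma le_on_G_if_AE_le:
  fixes h :: "'a \<Rightarrow> real"
  assumes "continuous_on UNIV h" "AE x in N. h x \<le> c" "Q \<in> G"
  shows "h Q \<le> c"
proof (rule ccontr)
  assume "\<not> h Q \<le> c"
  moreover have "open {x. c < h x}"
    using assms(1) by (intro open_Collect_less) auto
  ultimately obtain r where r: "r > 0" "ball Q r \<subseteq> {x. c < h x}"
    by (metis (mono_tags, lifting) mem_Collect_eq not_le open_contains_ball)
  have "AE x in N. x \<notin> ball Q r"
    using assms(2) by eventually_elim (use r in force)
  then have "emeasure N (ball Q r) = 0"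
    by (subst (asm) AE_iff_measurable[of "ball Q r"]) (auto simp: sets_eq_imp_space_eq[OF sets_M])
  then show False using emeasure_ball_pos[OF \<open>Q \<in> G\<close> \<open>r > 0\<close>] by simp
qed

lemma nn_integral_inner_power:
  assumes "compactly_supported_prob M G" "Q \<in> G"
  shows "(\<integral>\<^sup>+P. ennreal ((P \<bullet> Q) ^ k) \<partial>M) = ennreal (moment M k Q)" "0 \<le> moment M k Q"
proof -
  interpret M: compactly_supported_prob M G by fact
  have nonneg: "AE P in M. 0 \<le> (P \<bullet> Q) ^ k"
    using M.AE_G by eventually_elim (use inner_G_nonneg assms in auto)
  have "integrable M (\<lambda>P. (P \<bullet> Q) ^ k)"
    by (intro M.integrable_continuous continuous_intros)
  then show "(\<integral>\<^sup>+P. ennreal ((P \<bullet> Q) ^ k) \<partial>M) = ennreal (moment M k Q)"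
    using nonneg by (simp add: nn_integral_eq_integral moment_def)
  show "0 \<le> moment M k Q"
    using nonneg by (simp add: moment_def integral_nonneg_AE)
qed

lemma moment_const:
  assumes "P \<in> G" "Q \<in> G"
  shows "moment N k P = moment N k Q"
proof -
  have "ennreal (moment N k P) = ennreal (moment N k Q)"
    using isotropic[OF assms, of "\<lambda>t. ennreal (t ^ k)"] assms
    by (simp add: nn_integral_inner_power[OF compactly_supported_prob_axioms])
  then show ?thesis
    using nn_integral_inner_power(2)[OF compactly_supported_prob_axioms] assms by simp
qed

text \<open>The moment function of \<open>N\<close> is constant on \<open>G\<close>, where
  \<open>M\<close> is concentrated; symmetry of the mutual energy gives the second equation.\<close>

lemma mutual_moment_const:
  assumes "compactly_supported_prob M G" "Q \<in> G"
  shows "mutual_moment N M k = moment N k Q" "mutual_moment M N k = moment N k Q"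
proof -
  interpret M: compactly_supported_prob M G by fact
  have "mutual_moment N M k = (\<integral>P. moment N k Q \<partial>M)"
    unfolding mutual_moment_def
  proof (rule integral_cong_AE)
    show "AE P in M. moment N k P = moment N k Q"
      using M.AE_G by eventually_elim (rule moment_const[OF _ assms(2)])
  qed simp_all
  then show "mutual_moment N M k = moment N k Q" by (simp add: M.prob_space)
  then show "mutual_moment M N k = moment N k Q"
    using assms compactly_supported_prob_axioms by (simp add: mutual_moment_eq_sum mult.commute)
qed

lemma series_potential_eq_suminf:
  assumes M: "compactly_supported_prob M G" "Q \<in> G" and a: "\<And>k. 0 \<le> a k"
  shows "series_potential a M Q = (\<Sum>k. ennreal (a k * moment M k Q))"
proof -
  interpret M: compactly_supported_prob M G by fact
  have "series_potential a M Q = (\<Sum>k. \<integral>\<^sup>+P. ennreal (a k * (P \<bullet> Q) ^ k) \<partial>M)"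
    unfolding series_potential_def by (rule nn_integral_suminf) simp
  also have "\<dots> = (\<Sum>k. ennreal (a k * moment M k Q))"
    using a by (simp add: ennreal_mult' nn_integral_cmult nn_integral_inner_power[OF M])
  finally show ?thesis .
qed

lemma integrable_moment:
  assumes "compactly_supported_prob M G" "compactly_supported_prob M' G"
  shows "integrable M' (moment M k)"
  using assms compactly_supported_prob.continuous_on_moment compactly_supported_prob.integrable_continuous by blast

text \<open>The coefficients are kept general so that one argument serves both kernels. Only
  \<open>a 0\<close> may vanish, since moments of degree 0 are 1 for every probability
  measure.\<close>

lemma eq_if_series_potential_ge:
  assumes M: "compactly_supported_prob M G" and a: "\<And>k. 0 \<le> a k" "\<And>k. 0 < k \<Longrightarrow> 0 < a k"
    and Q0: "Q0 \<in> G" and fin: "series_potential a N Q0 < \<infinity>"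
    and ge: "\<And>Q. Q \<in> G \<Longrightarrow> series_potential a N Q0 \<le> series_potential a M Q"
  shows "M = N"
proof -
  interpret M: compactly_supported_prob M G by fact
  note N = compactly_supported_prob_axioms
  define c where "c k = moment N k Q0" for k
  have c_nonneg: "0 \<le> c k" for k
    using nn_integral_inner_power(2)[OF N Q0] by (simp add: c_def)
  define C where "C = (\<Sum>k. a k * c k)"
  have NC': "series_potential a N Q0 = (\<Sum>k. ennreal (a k * c k))"
    using series_potential_eq_suminf[OF N Q0 a(1)] by (simp add: c_def)
  have summ: "summable (\<lambda>k. a k * c k)"
    using fin a(1) c_nonneg unfolding NC' by (intro summable_suminf_not_top) auto
  then have NC: "series_potential a N Q0 = ennreal C"
    unfolding NC' C_def using a(1) c_nonneg by (intro suminf_ennreal2) auto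
  define p where "p Q = (\<Sum>k. ennreal (a k * moment M k Q))" for Q
  have [measurable]: "p \<in> borel_measurable borel"
    unfolding p_def by measurable
  have "AE Q in N. 0 \<le> moment M k Q" for k
    using AE_G by eventually_elim (rule nn_integral_inner_power(2)[OF M])
  \<comment> \<open>By Tonelli and symmetry, averaging the potential of \<open>M\<close> over
    \<open>N\<close> amounts to averaging the constant potential of \<open>N\<close> over
    \<open>M\<close>, which gives \<open>C\<close>.\<close>
  then have "(\<integral>\<^sup>+Q. ennreal (a k * moment M k Q) \<partial>N) = ennreal (a k * c k)" for k
    using a(1) mutual_moment_const(2)[OF M Q0, of k]
    by (simp add: ennreal_mult' nn_integral_cmult nn_integral_eq_integral integrable_moment[OF M N]
        mutual_moment_def c_def)
  then have int_p: "(\<integral>\<^sup>+Q. p Q \<partial>N) = ennreal C"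
    unfolding p_def by (subst nn_integral_suminf) (auto simp: NC'[symmetric] NC)
  have p_ge: "AE Q in N. ennreal C \<le> p Q"
    using AE_G by eventually_elim (use ge series_potential_eq_suminf[OF M _ a(1)] NC in \<open>auto simp: p_def\<close>)
  \<comment> \<open>A function that is at least its own finite mean equals it almost everywhere.
    Subtraction in \<open>ennreal\<close> is truncated, so \<open>p_ge\<close> is what permits
    splitting the integral.\<close>
  have "(\<integral>\<^sup>+Q. p Q - ennreal C \<partial>N) = (\<integral>\<^sup>+Q. p Q \<partial>N) - (\<integral>\<^sup>+Q. ennreal C \<partial>N)"
    using p_ge by (intro nn_integral_diff) (auto simp: emeasure_space_1)
  also have "\<dots> = 0" by (simp add: int_p emeasure_space_1)
  finally have "AE Q in N. p Q - ennreal C = 0"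
    by (subst (asm) nn_integral_0_iff_AE) auto
  then have p_le: "AE Q in N. p Q \<le> ennreal C"
    by eventually_elim (simp add: diff_eq_0_iff_ennreal)
  have C_nonneg: "0 \<le> C"
    unfolding C_def using summ a(1) c_nonneg by (intro suminf_nonneg) auto
  have partial: "(\<Sum>k<n. a k * moment M k Q) \<le> C" if "Q \<in> G" for n Q
  proof (rule le_on_G_if_AE_le[OF _ _ that])
    show "continuous_on UNIV (\<lambda>Q. \<Sum>k<n. a k * moment M k Q)"
      by (intro continuous_intros M.continuous_on_moment)
    show "AE Q in N. (\<Sum>k<n. a k * moment M k Q) \<le> C"
      using p_le AE_G
    proof eventually_elim
      case (elim Q)
      have "ennreal (\<Sum>k<n. a k * moment M k Q) = (\<Sum>k<n. ennreal (a k * moment M k Q))"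
        using a(1) nn_integral_inner_power(2)[OF M elim(2)] by (intro sum_ennreal[symmetric]) simp
      also have "\<dots> \<le> p Q" unfolding p_def by (rule sum_le_suminf) auto
      also note elim(1)
      finally show ?case using C_nonneg by (simp add: ennreal_le_iff)
    qed
  qed
  have energy: "(\<Sum>k<n. a k * mutual_moment M M k) \<le> C" for n
  proof -
    have "(\<Sum>k<n. a k * mutual_moment M M k) = (\<integral>Q. (\<Sum>k<n. a k * moment M k Q) \<partial>M)"
      unfolding mutual_moment_def using integrable_moment[OF M M]
      by (subst Bochner_Integration.integral_sum) simp_all
    also have "\<dots> \<le> (\<integral>Q. C \<partial>M)"
      using M.AE_G partial integrable_moment[OF M M]
      by (intro integral_mono_AE) (auto elim!: eventually_mono)
    finally show ?thesis by (simp add: M.prob_space)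
  qed
  \<comment> \<open>Expanding the squares gives the energies of \<open>M\<close> with itself, of
    \<open>M\<close> with \<open>N\<close> and of \<open>N\<close> with itself; the last two both
    equal \<open>c k\<close>.\<close>
  have square: "mutual_moment M M k - c k =
      (\<Sum>bs | set bs \<subseteq> Basis \<and> length bs = k. (monom_integral M bs - monom_integral N bs)\<^sup>2)" for k
  proof -
    let ?S = "{bs :: 'a list. set bs \<subseteq> Basis \<and> length bs = k}"
    have "(\<Sum>bs\<in>?S. (monom_integral M bs - monom_integral N bs)\<^sup>2) =
        (\<Sum>bs\<in>?S. monom_integral M bs * monom_integral M bs
          - 2 * (monom_integral M bs * monom_integral N bs) + monom_integral N bs * monom_integral N bs)"
      by (simp add: power2_eq_square algebra_simps)
    also have "\<dots> = mutual_moment M M k - 2 * mutual_moment M N k + mutual_moment N N k"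
      by (simp only: mutual_moment_eq_sum[OF M M] mutual_moment_eq_sum[OF M N] mutual_moment_eq_sum[OF N N]
          sum.distrib sum_subtractf sum_distrib_left)
    also have "\<dots> = mutual_moment M M k - c k"
      by (simp only: mutual_moment_const(2)[OF M Q0] mutual_moment_const(2)[OF N Q0] c_def)
    finally show ?thesis by (rule sym)
  qed
  have diff_nonneg: "0 \<le> mutual_moment M M k - c k" for k
    unfolding square by (intro sum_nonneg) simp
  have diff_zero: "mutual_moment M M k - c k = 0" if "0 < k" for k
  proof -
    \<comment> \<open>One nonnegative summand is at most the whole sum up to \<open>n\<close>, and
      by \<open>energy\<close> that sum is at most a tail of the series for \<open>C\<close>, which
      tends to 0.\<close>
    have "a k * (mutual_moment M M k - c k) \<le> C - (\<Sum>j<n. a j * c j)" if "n > k" for n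
    proof -
      have "a k * (mutual_moment M M k - c k) \<le> (\<Sum>j<n. a j * (mutual_moment M M j - c j))"
        using that a(1) diff_nonneg by (intro member_le_sum) auto
      also have "\<dots> \<le> C - (\<Sum>j<n. a j * c j)"
        using energy[of n] by (simp add: right_diff_distrib sum_subtractf)
      finally show ?thesis .
    qed
    moreover have "(\<lambda>n. C - (\<Sum>j<n. a j * c j)) \<longlonglongrightarrow> C - C"
      unfolding C_def by (intro tendsto_intros summable_LIMSEQ summ)
    ultimately have le: "a k * (mutual_moment M M k - c k) \<le> C - C"
      by (intro LIMSEQ_le_const[of _ "C - C"] exI[of _ "Suc k"]) auto
    have "\<not> 0 < mutual_moment M M k - c k"
    proof
      assume "0 < mutual_moment M M k - c k"
      from mult_pos_pos[OF a(2)[OF that] this] le show False by linarith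
    qed
    then show ?thesis using diff_nonneg[of k] by linarith
  qed
  show ?thesis
  proof (rule measure_eqI_inner_monom[OF M N])
    fix bs :: "'a list" assume bs: "set bs \<subseteq> Basis"
    show "(\<integral>x. inner_monom bs x \<partial>M) = (\<integral>x. inner_monom bs x \<partial>N)"
    proof (cases "bs = []")
      case True
      then show ?thesis by (simp add: inner_monom_def M.prob_space prob_space)
    next
      case False
      have "finite {cs :: 'a list. set cs \<subseteq> Basis \<and> length cs = length bs}"
        by (rule finite_lists_length_eq) simp
      then have "(monom_integral M bs - monom_integral N bs)\<^sup>2 = 0"
        using square[of "length bs"] diff_zero[of "length bs"] False bs
          sum_nonneg_eq_0_iff[of "{cs :: 'a list. set cs \<subseteq> Basis \<and> length cs = length bs}"
            "\<lambda>cs. (monom_integral M cs - monom_integral N cs)\<^sup>2"]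
        by auto
      then show ?thesis by (simp add: monom_integral_def)
    qed
  qed
qed

end

section \<open>The power and logarithmic kernels\<close>

text \<open>Taylor coefficients at 0 of \<open>1 - (1 - t) powr s\<close>; the constant terms
  cancel.\<close>

definition pow_coeff :: "real \<Rightarrow> nat \<Rightarrow> real" where
  "pow_coeff s k = (if k = 0 then 0 else - ((s gchoose k) * (-1) ^ k))"

text \<open>Taylor coefficients at 0 of \<open>- ln (1 - t)\<close>; division by zero yields the
  correct value 0 at \<open>k = 0\<close>.\<close>

definition log_coeff :: "nat \<Rightarrow> real" where
  "log_coeff k = 1 / real k"

text \<open>The coefficients start with \<open>s\<close> at degree 1 and satisfy
  \<open>(k + 1) * a (k + 1) = (k - s) * a k\<close>, where \<open>k - s\<close> is positive because
  \<open>s < 1\<close>.\<close>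

lemma pow_coeff_pos:
  assumes "0 < s" "s < 1" "0 < k"
  shows "0 < pow_coeff s k"
  using \<open>0 < k\<close>
proof (induction k rule: nat_induct_non_zero)
  case 1
  then show ?case using assms by (simp add: pow_coeff_def)
next
  case (Suc k)
  have step: "real (Suc k) * (s gchoose Suc k) = (s - real k) * (s gchoose k)"
    using gbinomial_mult_1[of s k] by (simp add: algebra_simps)
  have "real (Suc k) * pow_coeff s (Suc k) = (real (Suc k) * (s gchoose Suc k)) * (-1) ^ k"
    by (simp add: pow_coeff_def)
  also have "\<dots> = (real k - s) * pow_coeff s k"
    unfolding step using Suc.hyps by (simp add: pow_coeff_def algebra_simps)
  finally have "real (Suc k) * pow_coeff s (Suc k) = (real k - s) * pow_coeff s k" .
  moreover have "0 < (real k - s) * pow_coeff s k"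
    using Suc assms by (intro mult_pos_pos) auto
  ultimately show ?case
    by (metis of_nat_0_less_iff zero_less_Suc zero_less_mult_pos)
qed

text \<open>With nonnegative coefficients no Tauberian condition is required. Partial sums at 1 are
  limits of partial sums at \<open>t\<close>, hence at most \<open>L\<close>; conversely
  \<open>g t\<close> never exceeds the sum at 1.\<close>

lemma sums_at_1_if_nonneg:
  fixes a :: "nat \<Rightarrow> real"
  assumes a: "\<And>k. 0 \<le> a k" and sums: "\<And>t. 0 \<le> t \<Longrightarrow> t < 1 \<Longrightarrow> (\<lambda>k. a k * t ^ k) sums g t"
    and lim: "(g \<longlongrightarrow> L) (at_left 1)"
  shows "a sums L"
proof -
  have ev: "\<forall>\<^sub>F t in at_left (1::real). 0 \<le> t \<and> t < 1"
    by (auto simp: eventually_at_left[of 0 "1::real"] intro!: exI[of _ 0])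
  have partial: "(\<Sum>k<n. a k) \<le> L" for n
  proof (rule tendsto_le[OF _ lim])
    have "((\<lambda>t. \<Sum>k<n. a k * t ^ k) \<longlongrightarrow> (\<Sum>k<n. a k * 1 ^ k)) (at_left 1)"
      by (intro tendsto_intros)
    then show "((\<lambda>t. \<Sum>k<n. a k * t ^ k) \<longlongrightarrow> (\<Sum>k<n. a k)) (at_left 1)" by simp
    show "\<forall>\<^sub>F t in at_left 1. (\<Sum>k<n. a k * t ^ k) \<le> g t"
      using ev
    proof eventually_elim
      case (elim t)
      show ?case
        using sums[of t] elim a
        by (metis sums_iff sum_le_suminf finite_lessThan mult_nonneg_nonneg zero_le_power)
    qed
  qed simp
  have summ: "summable a"
    using a partial by (rule summableI_nonneg_bounded)
  moreover have "suminf a \<le> L"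
    using summ partial by (rule suminf_le_const)
  moreover have "L \<le> suminf a"
  proof (rule tendsto_le[OF _ tendsto_const lim])
    show "\<forall>\<^sub>F t in at_left 1. g t \<le> suminf a"
      using ev
    proof eventually_elim
      case (elim t)
      have "a k * t ^ k \<le> a k" for k
        using elim a[of k] by (simp add: mult_left_le power_le_one)
      then have "(\<Sum>k. a k * t ^ k) \<le> suminf a"
        using sums[of t] elim summ by (intro suminf_le) (auto simp: sums_iff)
      then show ?case using sums[of t] elim by (simp add: sums_iff)
    qed
  qed simp
  ultimately show ?thesis by (simp add: sums_iff)
qed

lemma pow_coeff_nonneg: "0 < s \<Longrightarrow> s < 1 \<Longrightarrow> 0 \<le> pow_coeff s k"
  using pow_coeff_pos[of s k] by (cases "k = 0") (auto simp: pow_coeff_def less_imp_le)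

lemma suminf_pow_coeff:
  assumes s: "0 < s" "s < 1" and t: "0 \<le> t" "t \<le> 1"
  shows "(\<Sum>k. ennreal (pow_coeff s k * t ^ k)) = ennreal (1 - (1 - t) powr s)"
proof -
  have less: "(\<lambda>k. pow_coeff s k * t ^ k) sums (1 - (1 - t) powr s)" if "0 \<le> t" "t < 1" for t
  proof -
    have "(\<lambda>k. (s gchoose k) * (- t) ^ k) sums (1 - t) powr s"
      using gen_binomial_real[of "- t" s] that by simp
    then have "(\<lambda>k. (if k = 0 then 1 else 0) - (s gchoose k) * (- t) ^ k) sums (1 - (1 - t) powr s)"
      by (intro sums_diff sums_single[of 0 "\<lambda>_. 1", simplified])
    moreover have "(if k = 0 then 1 else 0) - (s gchoose k) * (- t) ^ k = pow_coeff s k * t ^ k" for k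
      by (simp add: pow_coeff_def power_minus[of t])
    ultimately show ?thesis by simp
  qed
  have "(\<lambda>k. pow_coeff s k * t ^ k) sums (1 - (1 - t) powr s)"
  \<comment> \<open>The point \<open>t = 1\<close> is on the boundary of the disc of convergence.
    There the limit from the left is used; it is 1 because \<open>s > 0\<close> makes the power tend
    to 0.\<close>
  proof (cases "t = 1")
    case True
    have "((\<lambda>t. 1 - (1 - t) powr s) \<longlongrightarrow> 1 - (1 - 1) powr s) (at_left 1)"
      using s by (intro tendsto_intros tendsto_powr') (auto simp: eventually_at_filter)
    then have "pow_coeff s sums (1 - (1 - 1) powr s)"
      by (intro sums_at_1_if_nonneg[OF pow_coeff_nonneg[OF s] less])
    then show ?thesis using True by simp
  next
    case False
    then show ?thesis using less t by simp
  qed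
  then show ?thesis
    using pow_coeff_nonneg[OF s] t by (simp add: suminf_ennreal2 sums_iff)
qed

lemma suminf_log_coeff:
  assumes t: "0 \<le> t" "t \<le> 1"
  shows "(\<Sum>k. ennreal (log_coeff k * t ^ k)) = neglog1m t"
proof (cases "t = 1")
  case True
  have "(\<Sum>k. ennreal (log_coeff k)) = \<top>"
  proof (rule ccontr)
    assume "(\<Sum>k. ennreal (log_coeff k)) \<noteq> \<top>"
    then have "summable log_coeff"
      by (intro summable_suminf_not_top) (simp_all add: log_coeff_def)
    then show False
      using not_summable_harmonic[where 'a=real] by (simp add: log_coeff_def[abs_def] inverse_eq_divide)
  qed
  then show ?thesis using True by (simp add: neglog1m_def)
next
  case False
  then have "(\<lambda>k. - (t ^ k) / real k) sums ln (1 - t)"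
    using ln_series'[of "- t"] t by simp
  then have "(\<lambda>k. log_coeff k * t ^ k) sums (- ln (1 - t))"
    using sums_minus by (fastforce simp: log_coeff_def)
  then show ?thesis
    using False t by (simp add: suminf_ennreal2 sums_iff neglog1m_def log_coeff_def)
qed

lemma borel_measurable_neglog1m [measurable]: "neglog1m \<in> borel_measurable borel"
  unfolding neglog1m_def[abs_def] by measurable

section \<open>Ball estimates and finiteness of the logarithmic potential\<close>

context isotropic_prob
begin

text \<open>Packing along a curve that does not contract distances: the points with parameters
  \<open>i / n\<close> for \<open>i < n\<close> are at least \<open>1 / n\<close> apart, so the
  balls of half that radius are disjoint, and all have the same measure.\<close>

lemma prob_ball_le:
  fixes q :: "real \<Rightarrow> 'a"
  assumes q: "\<And>t. 0 \<le> t \<Longrightarrow> t \<le> 1 \<Longrightarrow> q t \<in> G" "\<And>s t. 0 \<le> s \<Longrightarrow> 0 \<le> t \<Longrightarrow> \<bar>s - t\<bar> \<le> dist (q s) (q t)"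
    and "Q \<in> G" "n > 0"
  shows "prob (ball Q (1 / (2 * real n))) \<le> 1 / real n"
proof -
  let ?r = "1 / (2 * real n)"
  let ?B = "\<lambda>i::nat. ball (q (real i / real n)) ?r"
  have disj: "disjoint_family_on ?B {..<n}"
  proof (unfold disjoint_family_on_def, intro ballI impI)
    fix i j assume ij: "i \<in> {..<n}" "j \<in> {..<n}" "i \<noteq> j"
    then have "1 \<le> \<bar>real i - real j\<bar>" by linarith
    then have "1 / real n \<le> \<bar>real i - real j\<bar> / real n"
      by (rule divide_right_mono) simp
    also have "\<dots> = \<bar>real i / real n - real j / real n\<bar>"
      by (simp flip: diff_divide_distrib)
    also have "\<dots> \<le> dist (q (real i / real n)) (q (real j / real n))"
      by (rule q(2)) auto
    finally show "?B i \<inter> ?B j = {}"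
      by (intro disjoint_ballI) simp
  qed
  have "real n * prob (ball Q ?r) = (\<Sum>i<n. prob (?B i))"
  proof -
    have "prob (?B i) = prob (ball Q ?r)" if "i < n" for i
      using emeasure_ball_eq[OF q(1) \<open>Q \<in> G\<close>, of "real i / real n" ?r] that by (simp add: measure_def)
    then show ?thesis by simp
  qed
  also have "\<dots> = prob (\<Union>i<n. ?B i)"
    using disj by (intro finite_measure_finite_Union[symmetric]) auto
  also have "\<dots> \<le> 1" by simp
  finally show ?thesis using \<open>n > 0\<close> by (simp add: field_simps)
qed

text \<open>With \<open>d\<close> the distance of two points, the kernel is \<open>ln 2 - 2 ln d\<close>, which is at most one plus
  twice the number of dyadic balls around the first point that contain the second.\<close>
lemma neglog1m_le_dyadic:
  assumes "P \<in> G" "Q \<in> G"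
  shows "neglog1m (P \<bullet> Q) \<le> 1 + (\<Sum>j. 2 * indicator (ball Q ((1/2) ^ j)) P)"
proof (cases "P = Q")
  case True
  have "(\<Sum>j. 2 * indicator (ball Q ((1/2) ^ j)) P) = (\<Sum>j::nat. ennreal 2)"
    using True by simp
  also have "\<dots> = \<top>"
  proof (rule ccontr)
    assume "(\<Sum>j::nat. ennreal 2) \<noteq> \<top>"
    then have "summable (\<lambda>j::nat. 2 :: real)" by (intro summable_suminf_not_top) simp_all
    then show False by (simp add: summable_const_iff)
  qed
  finally show ?thesis by simp
next
  case False
  define d where "d = dist P Q"
  have d: "d > 0" using False by (simp add: d_def)
  have PQ: "P \<bullet> Q = 1 - d\<^sup>2 / 2"
    using dist_sq_G[OF assms] by (simp add: d_def field_simps)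
  have "\<exists>m. (1/2) ^ m \<le> d"
    using real_arch_pow_inv[OF d, of "1/2"] less_imp_le by auto
  \<comment> \<open>\<open>m\<close> is used twice: \<open>(1/2) ^ m \<le> d\<close> bounds
    \<open>- ln d\<close> by \<open>m * ln 2\<close>, and minimality places \<open>P\<close> in the
    balls with index \<open>j < m\<close>.\<close>
  define m where "m = (LEAST m. (1/2) ^ m \<le> d)"
  have m: "(1/2) ^ m \<le> d" unfolding m_def by (rule LeastI_ex) fact
  have m_less: "d < (1/2) ^ j" if "j < m" for j
    using not_less_Least[of j "\<lambda>m. (1/2) ^ m \<le> d"] that by (simp add: m_def)
  have "- ln d \<le> real m * ln 2"
    using ln_mono[OF m] d by (simp add: ln_realpow ln_div power_divide)
  also have "\<dots> \<le> real m"
    using ln_le_minus_one[of 2] by (simp add: mult_left_le)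
  finally have "- ln (d\<^sup>2 / 2) \<le> 1 + real m * 2"
    using d ln_le_minus_one[of 2] by (simp add: ln_div ln_realpow)
  then have "ennreal (- ln (d\<^sup>2 / 2)) \<le> ennreal (1 + real m * 2)"
    by (rule ennreal_leI)
  moreover have "neglog1m (P \<bullet> Q) = ennreal (- ln (d\<^sup>2 / 2))"
    using d by (simp add: neglog1m_def PQ)
  ultimately have "neglog1m (P \<bullet> Q) \<le> ennreal (1 + real m * 2)" by simp
  also have "\<dots> = 1 + (\<Sum>j<m. 2 * indicator (ball Q ((1/2) ^ j)) P)"
  proof -
    have "(\<Sum>j<m. 2 * indicator (ball Q ((1/2) ^ j)) P) = (\<Sum>j<m. (2 :: ennreal))"
      using m_less by (intro sum.cong) (simp_all add: d_def dist_commute)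
    also have "\<dots> = ennreal (real m * 2)"
      by (simp add: ennreal_mult ennreal_of_nat_eq_real_of_nat)
    finally show ?thesis by simp
  qed
  also have "\<dots> \<le> 1 + (\<Sum>j. 2 * indicator (ball Q ((1/2) ^ j)) P)"
    by (intro add_left_mono sum_le_suminf) auto
  finally show ?thesis .
qed

text \<open>The dyadic bound is integrated term by term; the ball masses decay
  geometrically.\<close>

lemma nn_integral_neglog1m_finite:
  fixes q :: "real \<Rightarrow> 'a"
  assumes q: "\<And>t. 0 \<le> t \<Longrightarrow> t \<le> 1 \<Longrightarrow> q t \<in> G" "\<And>s t. 0 \<le> s \<Longrightarrow> 0 \<le> t \<Longrightarrow> \<bar>s - t\<bar> \<le> dist (q s) (q t)"
    and Q: "Q \<in> G"
  shows "(\<integral>\<^sup>+P. neglog1m (P \<bullet> Q) \<partial>N) < \<infinity>"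
proof -
  have [measurable]: "ball Q r \<in> sets borel" for r by simp
  \<comment> \<open>For \<open>j = 0\<close> the mass is at most 1. For \<open>j = i + 1\<close> the
    radius is \<open>1 / (2 * 2 ^ i)\<close>, so the packing bound with \<open>n = 2 ^ i\<close>
    gives \<open>(1/2) ^ i\<close>, which is \<open>2 * (1/2) ^ j\<close>.\<close>
  have ball: "emeasure N (ball Q ((1/2) ^ j)) \<le> ennreal (2 * (1/2) ^ j)" for j
  proof (cases j)
    case 0
    then show ?thesis
      using order_trans[OF emeasure_le_1[of "ball Q 1"], of 2] by simp
  next
    case (Suc i)
    then show ?thesis
      using prob_ball_le[OF q Q, of "2 ^ i"] by (simp add: emeasure_eq_measure ennreal_leI power_divide)
  qed
  have "(\<integral>\<^sup>+P. neglog1m (P \<bullet> Q) \<partial>N) \<le> (\<integral>\<^sup>+P. 1 + (\<Sum>j. 2 * indicator (ball Q ((1/2) ^ j)) P) \<partial>N)"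
  proof (rule nn_integral_mono_AE)
    show "AE P in N. neglog1m (P \<bullet> Q) \<le> 1 + (\<Sum>j. 2 * indicator (ball Q ((1/2) ^ j)) P)"
      using AE_G by eventually_elim (rule neglog1m_le_dyadic[OF _ Q])
  qed
  also have "\<dots> = (\<integral>\<^sup>+P. 1 \<partial>N) + (\<integral>\<^sup>+P. (\<Sum>j. 2 * indicator (ball Q ((1/2) ^ j)) P) \<partial>N)"
    by (rule nn_integral_add) measurable
  also have "(\<integral>\<^sup>+P. (\<Sum>j. 2 * indicator (ball Q ((1/2) ^ j)) P) \<partial>N) =
      (\<Sum>j. \<integral>\<^sup>+P. 2 * indicator (ball Q ((1/2) ^ j)) P \<partial>N)"
    by (rule nn_integral_suminf) measurable
  also have "(\<integral>\<^sup>+P. 1 \<partial>N) + (\<Sum>j. \<integral>\<^sup>+P. 2 * indicator (ball Q ((1/2) ^ j)) P \<partial>N) =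
      1 + (\<Sum>j. 2 * emeasure N (ball Q ((1/2) ^ j)))"
    by (simp add: nn_integral_cmult_indicator emeasure_space_1)
  also have "\<dots> \<le> 1 + (\<Sum>j. ennreal (4 * (1/2) ^ j))"
  proof (intro add_left_mono suminf_le)
    fix j :: nat
    have "2 * emeasure N (ball Q ((1/2) ^ j)) \<le> 2 * ennreal (2 * (1/2) ^ j)"
      using ball by (intro mult_left_mono) auto
    also have "\<dots> = ennreal 2 * ennreal (2 * (1/2) ^ j)" by simp
    also have "\<dots> = ennreal (2 * (2 * (1/2) ^ j))"
      by (rule ennreal_mult[symmetric]) simp_all
    also have "\<dots> = ennreal (4 * (1/2) ^ j)" by simp
    finally show "2 * emeasure N (ball Q ((1/2) ^ j)) \<le> ennreal (4 * (1/2) ^ j)" .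
  qed auto
  also have "\<dots> = 1 + ennreal (\<Sum>j. 4 * (1/2) ^ j)"
    by (subst suminf_ennreal2) (auto intro!: summable_mult summable_geometric)
  also have "\<dots> < \<infinity>" by simp
  finally show ?thesis .
qed

end

section \<open>Lines in real and complex space\<close>

text \<open>A common frame for the identity on the reals and \<open>cnj\<close> on the complex
  numbers. \<open>of_real_inner\<close> expresses that the real inner product is the real part of
  \<open>a * cj b\<close>, doubled to avoid a real-part operation.\<close>

locale conj_field =
  fixes cj :: "'f::{real_normed_field,euclidean_space} \<Rightarrow> 'f"
  assumes cj_add: "cj (a + b) = cj a + cj b"
    and cj_mult: "cj (a * b) = cj a * cj b"
    and cj_cj [simp]: "cj (cj a) = a"
    and cj_of_real [simp]: "cj (of_real r) = of_real r"
    and mult_cj: "a * cj a = of_real ((norm a)\<^sup>2)"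
    and of_real_inner: "2 * of_real (a \<bullet> b) = a * cj b + cj a * b"
    and continuous_cj: "continuous_on UNIV cj"
begin

lemma cj_0 [simp]: "cj 0 = 0" and cj_1 [simp]: "cj 1 = 1"
  using cj_of_real[of 0] cj_of_real[of 1] by simp_all

lemma cj_sum: "cj (sum f A) = (\<Sum>i\<in>A. cj (f i))"
  by (induction A rule: infinite_finite_induct) (simp_all add: cj_add)

lemma cj_minus: "cj (- a) = - cj a"
  using cj_add[of a "- a"] by (simp add: eq_neg_iff_add_eq_0 add.commute)

lemma cj_diff: "cj (a - b) = cj a - cj b"
  using cj_add[of a "- b"] by (simp add: cj_minus)

definition hinner :: "'f^'n \<Rightarrow> 'f^'n \<Rightarrow> 'f" where
  "hinner x y = (\<Sum>i\<in>UNIV. x$i * cj (y$i))"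

lemma cj_hinner: "cj (hinner x y) = hinner y x"
  by (simp add: hinner_def cj_sum cj_mult mult.commute)

lemma hinner_self: "hinner x x = of_real ((norm x)\<^sup>2)"
  by (simp add: hinner_def mult_cj norm_vec_def L2_set_def sum_nonneg)

lemma hinner_diff_left: "hinner (x - y) z = hinner x z - hinner y z"
  and hinner_diff_right: "hinner z (x - y) = hinner z x - hinner z y"
  by (simp_all add: hinner_def cj_diff algebra_simps sum_subtractf)

lemma proj_line_mult_vec: "proj_line cj v *v x = hinner x v *s v"
  by (simp add: proj_line_def hinner_def vec_eq_iff matrix_vector_mult_def sum_distrib_left sum_distrib_right mult_ac)

lemma norm_vec_smult: "norm (c *s (x :: 'f^'n)) = norm c * norm x"
  by (simp add: norm_vec_def L2_set_def norm_mult power_mult_distrib real_sqrt_mult flip: sum_distrib_left)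

text \<open>The trace formula for two rank-one matrices. By \<open>of_real_inner\<close> twice the
  left side is a sum of two conjugate double sums, and each factors into \<open>hinner x y\<close>
  times its conjugate.\<close>

lemma inner_proj_line: "proj_line cj x \<bullet> proj_line cj y = (norm (hinner x y))\<^sup>2"
proof -
  have "2 * of_real (proj_line cj x \<bullet> proj_line cj y) =
      (\<Sum>i\<in>UNIV. \<Sum>j\<in>UNIV. 2 * of_real ((x$i * cj (x$j)) \<bullet> (y$i * cj (y$j))) :: 'f)"
    by (simp add: inner_vec_def proj_line_def sum_distrib_left)
  also have "\<dots> = (\<Sum>i\<in>UNIV. \<Sum>j\<in>UNIV. (x$i * cj (y$i)) * (cj (x$j) * y$j))
      + (\<Sum>i\<in>UNIV. \<Sum>j\<in>UNIV. (cj (x$i) * y$i) * (x$j * cj (y$j)))"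
    by (simp add: of_real_inner cj_mult sum.distrib mult_ac)
  also have "(\<Sum>i\<in>UNIV. \<Sum>j\<in>UNIV. (x$i * cj (y$i)) * (cj (x$j) * y$j)) = hinner x y * hinner y x"
    unfolding hinner_def sum_product by (simp add: mult_ac)
  also have "(\<Sum>i\<in>UNIV. \<Sum>j\<in>UNIV. (cj (x$i) * y$i) * (x$j * cj (y$j))) = hinner y x * hinner x y"
    unfolding hinner_def sum_product by (simp add: mult_ac)
  also have "hinner x y * hinner y x + hinner y x * hinner x y = 2 * of_real ((norm (hinner x y))\<^sup>2)"
  proof -
    have "hinner x y * hinner y x = of_real ((norm (hinner x y))\<^sup>2)"
      using mult_cj[of "hinner x y"] by (simp only: cj_hinner)
    moreover from this have "hinner y x * hinner x y = of_real ((norm (hinner x y))\<^sup>2)"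
      by (simp only: mult.commute)
    ultimately show ?thesis by (simp only: mult_2)
  qed
  finally have "(of_real (proj_line cj x \<bullet> proj_line cj y) :: 'f) = of_real ((norm (hinner x y))\<^sup>2)"
    by simp
  then show ?thesis by (simp only: of_real_eq_iff)
qed

lemma norm_proj_line_mult_vec:
  assumes "norm v = 1"
  shows "(norm (proj_line cj v *v x))\<^sup>2 = proj_line cj v \<bullet> proj_line cj x"
  using assms inner_proj_line[of x v]
  by (simp add: proj_line_mult_vec norm_vec_smult inner_commute[of "proj_line cj v"])

lemma norm_Grass1: "P \<in> Grass1 cj \<Longrightarrow> norm P = 1"
  by (auto simp: Grass1_def norm_eq_sqrt_inner[of "proj_line cj _"] inner_proj_line hinner_self)

lemma inner_Grass1:
  assumes "P \<in> Grass1 cj" "Q \<in> Grass1 cj"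
  shows "0 \<le> P \<bullet> Q" "P \<bullet> Q \<le> 1"
  using assms norm_cauchy_schwarz[of P Q] norm_Grass1[OF assms(1)] norm_Grass1[OF assms(2)]
  by (auto simp: Grass1_def inner_proj_line)

lemma compact_Grass1: "compact (Grass1 cj :: ('f^'n^'n) set)"
proof -
  have "continuous_on UNIV (\<lambda>v :: 'f^'n. proj_line cj v)"
    unfolding proj_line_def
    by (intro continuous_intros continuous_on_compose2[OF continuous_cj]) auto
  then have "compact (proj_line cj ` sphere (0 :: 'f^'n) 1)"
    by (intro compact_continuous_image) (auto intro: continuous_on_subset)
  moreover have "proj_line cj ` sphere (0 :: 'f^'n) 1 = (Grass1 cj :: ('f^'n^'n) set)"
    by (auto simp: Grass1_def)
  ultimately show ?thesis by simp
qed

section \<open>The unitary action on lines and its transitivity\<close>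

lemma hinner_adj: "hinner (U *v x) y = hinner x (adj cj U *v y)"
proof -
  have "hinner (U *v x) y = (\<Sum>i\<in>UNIV. \<Sum>j\<in>UNIV. U$i$j * x$j * cj (y$i))"
    by (simp add: hinner_def matrix_vector_mult_def sum_distrib_right)
  also have "\<dots> = (\<Sum>j\<in>UNIV. \<Sum>i\<in>UNIV. U$i$j * x$j * cj (y$i))"
    by (rule sum.swap)
  also have "\<dots> = hinner x (adj cj U *v y)"
    by (simp add: hinner_def matrix_vector_mult_def adj_def sum_distrib_left cj_sum cj_mult mult_ac)
  finally show ?thesis .
qed

lemma hinner_unitary: "unitary_mat cj U \<Longrightarrow> hinner (U *v x) (U *v y) = hinner x y"
  by (simp add: hinner_adj matrix_vector_mul_assoc unitary_mat_def)

lemma norm_unitary: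
  assumes "unitary_mat cj U" shows "norm (U *v x) = norm x"
proof -
  have "(of_real ((norm (U *v x))\<^sup>2) :: 'f) = of_real ((norm x)\<^sup>2)"
    using hinner_unitary[OF assms, of x x] by (simp only: hinner_self)
  then show ?thesis by (simp only: of_real_eq_iff power2_eq_iff_nonneg norm_ge_zero)
qed

lemma proj_line_conjugate: "U ** proj_line cj v ** adj cj U = proj_line cj (U *v v)"
proof -
  have "(U ** proj_line cj v ** adj cj U) $ i $ j = proj_line cj (U *v v) $ i $ j" for i j
  proof -
    have "proj_line cj (U *v v) $ i $ j
       = (\<Sum>k\<in>UNIV. U$i$k * v$k) * (\<Sum>l\<in>UNIV. cj (U$j$l) * cj (v$l))"
      by (simp add: proj_line_def matrix_vector_mult_def cj_sum cj_mult)
    also have "\<dots> = (\<Sum>l\<in>UNIV. (\<Sum>k\<in>UNIV. U$i$k * v$k) * (cj (U$j$l) * cj (v$l)))"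
      by (simp add: sum_distrib_left)
    also have "\<dots> = (U ** proj_line cj v ** adj cj U) $ i $ j"
      by (simp add: proj_line_def matrix_matrix_mult_def adj_def sum_distrib_left sum_distrib_right mult_ac)
    finally show ?thesis by simp
  qed
  then show ?thesis by (simp add: vec_eq_iff)
qed

lemma proj_line_phase: "norm c = 1 \<Longrightarrow> proj_line cj (c *s v) = proj_line cj v"
proof -
  assume "norm c = 1"
  then have "c * a * (cj c * b) = a * b" for a b
    using mult_cj[of c] by (metis mult.assoc mult.left_commute mult_1 of_real_1 power_one)
  then show ?thesis by (simp add: proj_line_def vec_eq_iff cj_mult)
qed

text \<open>The reflection is self-adjoint, and in its square the terms \<open>- 2 * k * P\<close>
  and \<open>k * k * hinner w w * P\<close> cancel exactly under the assumption on
  \<open>k\<close>.\<close>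

lemma householder_unitary:
  fixes w :: "'f^'n"
  assumes w: "of_real k * hinner w w = 2"
  shows "unitary_mat cj (mat 1 - k *\<^sub>R proj_line cj w)"
proof -
  let ?P = "proj_line cj w"
  let ?H = "mat 1 - k *\<^sub>R ?P"
  have adjP: "adj cj ?H = ?H"
    by (simp add: vec_eq_iff adj_def proj_line_def mat_def cj_diff cj_mult scaleR_conv_of_real[where 'a='f] mult_ac)
  have PP: "(\<Sum>l\<in>UNIV. ?P$i$l * ?P$l$j) = hinner w w * ?P$i$j" for i j
    by (simp add: proj_line_def hinner_def sum_distrib_left sum_distrib_right mult_ac)
  have "(?H ** ?H) $ i $ j = mat 1 $ i $ j" for i j
  proof -
    have "(?H ** ?H) $ i $ j = (\<Sum>l\<in>UNIV. (mat 1 $ i $ l - of_real k * ?P$i$l) * (mat 1 $ l $ j - of_real k * ?P$l$j))"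
      by (simp add: matrix_matrix_mult_def scaleR_conv_of_real[where 'a='f] algebra_simps)
    also have "\<dots> = (\<Sum>l\<in>UNIV. mat 1 $ i $ l * mat 1 $ l $ j)
        - of_real k * (\<Sum>l\<in>UNIV. mat 1 $ i $ l * ?P$l$j) - of_real k * (\<Sum>l\<in>UNIV. ?P$i$l * mat 1 $ l $ j)
        + of_real k * of_real k * (\<Sum>l\<in>UNIV. ?P$i$l * ?P$l$j)"
      by (simp add: algebra_simps sum.distrib sum_subtractf sum_distrib_left)
    also have "\<dots> = mat 1 $ i $ j - 2 * of_real k * ?P$i$j + of_real k * (of_real k * hinner w w) * ?P$i$j"
    proof -
      have "(\<Sum>l\<in>UNIV. mat 1 $ i $ l * A$l$j) = A$i$j" "(\<Sum>l\<in>UNIV. A$i$l * mat 1 $ l $ j) = A$i$j" for A :: "'f^'n^'n"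
        using arg_cong[OF matrix_mul_lid[of A], of "\<lambda>B. B$i$j"] arg_cong[OF matrix_mul_rid[of A], of "\<lambda>B. B$i$j"]
        by (simp_all add: matrix_matrix_mult_def)
      then show ?thesis unfolding PP by (simp only:) (simp add: algebra_simps)
    qed
    also have "\<dots> = mat 1 $ i $ j" using w by simp
    finally show ?thesis .
  qed
  then show ?thesis by (simp add: unitary_mat_def adjP vec_eq_iff)
qed

text \<open>The reflection along the difference of two unit vectors exchanges them when their inner
  product is real. A change of phase of \<open>y\<close> achieves this without moving its
  line.\<close>

lemma unitary_transitive:
  assumes "P \<in> Grass1 cj" "Q \<in> Grass1 cj"
  obtains U where "unitary_mat cj U" "U ** P ** adj cj U = Q"
proof -
  obtain x y where x: "norm x = 1" "P = proj_line cj x" and y: "norm y = 1" "Q = proj_line cj y"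
    using assms by (auto simp: Grass1_def)
  define z where "z = hinner x y"
  \<comment> \<open>The phase of \<open>z\<close>, so that \<open>hinner x (c *s y)\<close> becomes
    the nonnegative real \<open>norm z\<close>; any phase serves when \<open>z = 0\<close>.\<close>
  define c where "c = (if z = 0 then 1 else z / of_real (norm z))"
  have c: "norm c = 1" by (simp add: c_def norm_divide)
  define y' where "y' = c *s y"
  have y': "norm y' = 1" "Q = proj_line cj y'"
    using c y by (simp_all add: y'_def norm_vec_smult proj_line_phase)
  have "hinner x y' = cj c * z"
    by (simp add: hinner_def y'_def z_def cj_mult sum_distrib_left mult_ac)
  also have "\<dots> = of_real (norm z)"
  proof (cases "z = 0")
    case False
    have "cj (1 / of_real (norm z)) = (1 / of_real (norm z) :: 'f)"
      using cj_of_real[of "1 / norm z"] by simp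
    then have "cj c = cj z * (1 / of_real (norm z))"
      using False cj_mult[of z "1 / of_real (norm z)"] by (simp add: c_def)
    then have "cj c * z = (z * cj z) / of_real (norm z)" by simp
    then show ?thesis using False by (simp add: mult_cj power2_eq_square)
  qed simp
  finally have xy: "hinner x y' = of_real (norm z)" .
  then have yx: "hinner y' x = of_real (norm z)" using cj_hinner[of x y'] by simp
  define w where "w = x - y'"
  have xx: "hinner x x = 1" "hinner y' y' = 1" using x y' by (simp_all add: hinner_self)
  have hxw: "hinner x w = of_real (1 - norm z)"
    by (simp add: w_def hinner_diff_right xx xy)
  have hww: "hinner w w = of_real (2 * (1 - norm z))"
    by (simp add: w_def hinner_diff_right hinner_diff_left xx xy yx)
  show ?thesis
  proof (cases "w = 0")
    case True
    have "adj cj (mat 1 :: 'f^'n^'n) = mat 1"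
      by (simp add: adj_def vec_eq_iff mat_def)
    then have "unitary_mat cj (mat 1 :: 'f^'n^'n)"
      by (simp add: unitary_mat_def)
    moreover have "mat 1 ** P ** adj cj (mat 1) = Q"
      using True x y' proj_line_conjugate[of "mat 1" x] by (simp add: w_def)
    ultimately show ?thesis by (rule that)
  next
    case False
    have nz: "1 - norm z \<noteq> 0" using hww hinner_self[of w] False by auto
    \<comment> \<open>This is \<open>2\<close> divided by \<open>hinner w w\<close>. It also makes
      \<open>k * hinner x w\<close> equal to 1, so the reflection sends \<open>x\<close> to
      \<open>x - w = y'\<close>.\<close>
    define k where "k = 1 / (1 - norm z)"
    define H where "H = mat 1 - k *\<^sub>R proj_line cj w"
    have k: "(of_real k * of_real (1 - norm z) :: 'f) = 1"
      using nz by (simp add: k_def flip: of_real_mult of_real_diff)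
    have "of_real k * hinner w w = 2 * (of_real k * of_real (1 - norm z))" by (simp add: hww)
    then have "unitary_mat cj H"
      unfolding H_def by (intro householder_unitary) (simp only: k mult_1_right)
    moreover have "H *v x = y'"
    proof -
      have "H *v x = x - k *\<^sub>R (proj_line cj w *v x)"
        by (simp add: H_def matrix_vector_mult_diff_rdistrib)
          (simp add: vec_eq_iff matrix_vector_mult_def scaleR_sum_right algebra_simps)
      also have "k *\<^sub>R (proj_line cj w *v x) = (of_real k * of_real (1 - norm z)) *s w"
        by (simp add: proj_line_mult_vec hxw vec_eq_iff scaleR_conv_of_real[where 'a='f] algebra_simps)
      finally show ?thesis unfolding k by (simp add: w_def)
    qed
    ultimately show ?thesis
      using that[of H] x y' by (simp add: proj_line_conjugate)
  qed
qed

lemma conjugate_Grass1: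
  assumes "unitary_mat cj U" "P \<in> Grass1 cj"
  shows "U ** P ** adj cj U \<in> Grass1 cj"
proof -
  obtain v where "norm v = 1" "P = proj_line cj v" using assms by (auto simp: Grass1_def)
  moreover have "norm (U *v v) = 1" using assms(1) \<open>norm v = 1\<close> by (simp add: norm_unitary)
  ultimately show ?thesis unfolding Grass1_def by (auto simp: proj_line_conjugate)
qed

lemma inner_conjugate_Grass1:
  assumes "unitary_mat cj U" "P \<in> Grass1 cj" "Q \<in> Grass1 cj"
  shows "(U ** P ** adj cj U) \<bullet> (U ** Q ** adj cj U) = P \<bullet> Q"
  using assms by (auto simp: Grass1_def proj_line_conjugate hinner_unitary inner_proj_line)

text \<open>The lines spanned by \<open>sqrt (1 - t) * e_a + sqrt t * e_b\<close> for two distinct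
  coordinates: the \<open>(b, b)\<close> entry of the projection is \<open>t\<close>, and an entry
  difference is at most the Frobenius distance.\<close>

lemma Grass1_separated:
  assumes "CARD('n) \<ge> 2"
  obtains q :: "real \<Rightarrow> 'f^'n^'n" where
    "\<And>t. 0 \<le> t \<Longrightarrow> t \<le> 1 \<Longrightarrow> q t \<in> Grass1 cj" "\<And>s t. 0 \<le> s \<Longrightarrow> 0 \<le> t \<Longrightarrow> \<bar>s - t\<bar> \<le> dist (q s) (q t)"
proof -
  obtain a b :: 'n where ab: "a \<noteq> b"
    using assms by (metis (full_types) card_2_iff' ex_card top.extremum UNIV_I)
  define v :: "real \<Rightarrow> 'f^'n" where
    "v t = (\<chi> i. if i = a then of_real (sqrt (1 - t)) else if i = b then of_real (sqrt t) else 0)" for t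
  have nv: "norm (v t) = 1" if "0 \<le> t" "t \<le> 1" for t
  proof -
    have "(\<Sum>i\<in>UNIV. (norm (v t $ i))\<^sup>2) = (\<Sum>i\<in>{a, b}. (norm (v t $ i))\<^sup>2)"
      by (rule sum.mono_neutral_right) (auto simp: v_def)
    also have "\<dots> = 1" using ab that by (simp add: v_def)
    finally show ?thesis by (simp add: norm_vec_def L2_set_def)
  qed
  have entry: "proj_line cj (v t) $ b $ b = of_real t" if "0 \<le> t" for t
    using ab that by (simp add: proj_line_def v_def flip: of_real_mult)
  show ?thesis
  proof (rule that[of "\<lambda>t. proj_line cj (v t)"])
    fix s t :: real assume "0 \<le> s" "0 \<le> t"
    then have "\<bar>s - t\<bar> = norm ((proj_line cj (v s) - proj_line cj (v t)) $ b $ b)"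
      using norm_of_real[of "s - t", where 'a='f] by (simp add: entry)
    also have "\<dots> \<le> norm (proj_line cj (v s) - proj_line cj (v t))"
      by (meson Finite_Cartesian_Product.norm_nth_le order_trans)
    finally show "\<bar>s - t\<bar> \<le> dist (proj_line cj (v s)) (proj_line cj (v t))" by (simp add: dist_norm)
  qed (use nv in \<open>auto simp: Grass1_def\<close>)
qed
end

lemma conj_field_id: "conj_field (id :: real \<Rightarrow> real)"
  by unfold_locales (auto simp: power2_eq_square)

lemma conj_field_cnj: "conj_field cnj"
  using complex_norm_square[symmetric]
  by unfold_locales (auto simp: complex_eq_iff inner_complex_def intro!: continuous_intros)

section \<open>Unique minimality\<close>

text \<open>The identity map changes only the sigma-algebra: a measure on the subspace of lines
  becomes a Borel measure on the whole matrix space, where the results on moments and energies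
  apply.\<close>

definition push_borel :: "'a::topological_space measure \<Rightarrow> 'a measure" where
  "push_borel \<mu> = distr \<mu> borel (\<lambda>x. x)"

lemma SUP_const_nonempty: "x \<in> A \<Longrightarrow> (SUP y\<in>A. c :: 'b::conditionally_complete_lattice) = c"
  by (rule cSUP_const) auto

text \<open>In a linear order minimality follows from uniqueness: a competitor with a strictly
  smaller value would have to equal \<open>\<Gamma>\<close>.\<close>

lemma unique_minimizerI:
  fixes F :: "('f::real_normed_field^'n^'n) measure \<Rightarrow> 'b::linorder"
  assumes "borel_prob_G cj \<Gamma>" "\<And>\<mu>. borel_prob_G cj \<mu> \<Longrightarrow> F \<mu> \<le> F \<Gamma> \<Longrightarrow> \<mu> = \<Gamma>"
  shows "unique_minimizer cj F \<Gamma>"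
  unfolding unique_minimizer_def using assms by (metis linear)

context conj_field
begin

lemma borel_prob_G_measurable:
  assumes "borel_prob_G cj \<mu>"
  shows "space \<mu> = Grass1 cj" "(\<lambda>x. x) \<in> measurable \<mu> borel"
proof -
  have sets: "sets \<mu> = sets (restrict_space borel (Grass1 cj))"
    using assms by (simp add: borel_prob_G_def)
  show "space \<mu> = Grass1 cj"
    using sets_eq_imp_space_eq[OF sets] by (simp add: space_restrict_space)
  show "(\<lambda>x. x) \<in> measurable \<mu> borel"
    unfolding measurable_cong_sets[OF sets refl] by (intro measurable_restrict_space1) simp
qed

lemma compactly_supported_push_borel:
  fixes \<mu> :: "('f^'n^'n) measure"
  assumes "borel_prob_G cj \<mu>"
  shows "compactly_supported_prob (push_borel \<mu>) (Grass1 cj)"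
proof -
  interpret prob_space \<mu> using assms by (simp add: borel_prob_G_def)
  note m = borel_prob_G_measurable[OF assms]
  interpret P: prob_space "push_borel \<mu>"
    unfolding push_borel_def using m(2) by (rule prob_space_distr)
  have "(Grass1 cj :: ('f^'n^'n) set) \<in> sets borel"
    by (intro borel_closed compact_imp_closed compact_Grass1)
  then have "AE x in push_borel \<mu>. x \<in> Grass1 cj"
    unfolding push_borel_def using m by (subst AE_distr_iff) auto
  then show ?thesis
    by unfold_locales (simp_all add: push_borel_def compact_Grass1)
qed

lemma push_borel_inject:
  assumes "borel_prob_G cj \<mu>" "borel_prob_G cj \<nu>" "push_borel \<mu> = push_borel \<nu>"
  shows "\<mu> = \<nu>"
proof (rule measure_eqI)
  show "sets \<mu> = sets \<nu>" using assms by (simp add: borel_prob_G_def)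
  fix A assume A: "A \<in> sets \<mu>"
  then obtain B where B: "B \<in> sets borel" "A = Grass1 cj \<inter> B"
    using assms(1) by (auto simp: borel_prob_G_def sets_restrict_space)
  have "emeasure \<rho> A = emeasure (push_borel \<rho>) B" if "borel_prob_G cj \<rho>" for \<rho>
    using borel_prob_G_measurable[OF that] B by (simp add: push_borel_def emeasure_distr Int_commute)
  then show "emeasure \<mu> A = emeasure \<nu> A" using assms by simp
qed

lemma nn_integral_push_borel:
  assumes "borel_prob_G cj \<mu>" "f \<in> borel_measurable borel"
  shows "(\<integral>\<^sup>+x. f x \<partial>push_borel \<mu>) = (\<integral>\<^sup>+x. f x \<partial>\<mu>)"
  unfolding push_borel_def using borel_prob_G_measurable[OF assms(1)] assms(2)
  by (intro nn_integral_distr) simp_all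

text \<open>A unitary conjugation carrying \<open>P\<close> to \<open>Q\<close> preserves both
  \<open>\<Gamma>\<close> and inner products of projections.\<close>

lemma isotropic_push_borel:
  fixes \<Gamma> :: "('f^'n^'n) measure"
  assumes "invariant_G cj \<Gamma>"
  shows "isotropic_prob (push_borel \<Gamma>) (Grass1 cj)"
proof -
  have \<Gamma>: "borel_prob_G cj \<Gamma>" using assms by (simp add: invariant_G_def)
  interpret compactly_supported_prob "push_borel \<Gamma>" "Grass1 cj"
    by (rule compactly_supported_push_borel) fact
  show ?thesis
  proof
    fix P Q :: "'f^'n^'n" and f :: "real \<Rightarrow> ennreal"
    assume P: "P \<in> Grass1 cj" and Q: "Q \<in> Grass1 cj" and f [measurable]: "f \<in> borel_measurable borel"
    obtain U where U: "unitary_mat cj U" "U ** P ** adj cj U = Q"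
      using unitary_transitive[OF P Q] .
    let ?T = "\<lambda>P. U ** P ** adj cj U"
    have "continuous_on UNIV ?T"
      unfolding matrix_matrix_mult_def by (intro continuous_intros)
    then have "?T \<in> borel_measurable borel" by (rule borel_measurable_continuous_onI)
    \<comment> \<open>\<open>invariant_G\<close> has \<open>\<Gamma>\<close> itself as the target of
      \<open>distr\<close>, so measurability is required into the trace sigma-algebra, and the map
      must stay in \<open>Grass1 cj\<close>.\<close>
    from measurable_compose[OF borel_prob_G_measurable(2)[OF \<Gamma>] this]
    have T: "?T \<in> measurable \<Gamma> \<Gamma>"
      using conjugate_Grass1[OF U(1)] borel_prob_G_measurable(1)[OF \<Gamma>] \<Gamma>
      by (subst measurable_cong_sets[OF refl, of _ "restrict_space borel (Grass1 cj)"])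
        (auto simp: borel_prob_G_def intro!: measurable_restrict_space2)
    have fm: "(\<lambda>x. f (x \<bullet> R)) \<in> borel_measurable borel" for R :: "'f^'n^'n" by measurable
    then have fm': "(\<lambda>x. f (x \<bullet> R)) \<in> borel_measurable \<Gamma>" for R
      using measurable_compose[OF borel_prob_G_measurable(2)[OF \<Gamma>]] by blast
    have "(\<integral>\<^sup>+x. f (x \<bullet> Q) \<partial>\<Gamma>) = (\<integral>\<^sup>+x. f (x \<bullet> Q) \<partial>distr \<Gamma> \<Gamma> ?T)"
      using assms U(1) by (simp add: invariant_G_def)
    also have "\<dots> = (\<integral>\<^sup>+x. f (?T x \<bullet> Q) \<partial>\<Gamma>)"
      by (rule nn_integral_distr[OF T]) (simp add: fm')
    also have "\<dots> = (\<integral>\<^sup>+x. f (x \<bullet> P) \<partial>\<Gamma>)"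
      using inner_conjugate_Grass1[OF U(1) _ P] U(2) borel_prob_G_measurable(1)[OF \<Gamma>]
      by (intro nn_integral_cong) auto
    finally show "(\<integral>\<^sup>+x. f (x \<bullet> P) \<partial>push_borel \<Gamma>) = (\<integral>\<^sup>+x. f (x \<bullet> Q) \<partial>push_borel \<Gamma>)"
      by (simp add: nn_integral_push_borel[OF \<Gamma> fm])
  qed (auto simp: norm_Grass1 inner_Grass1)
qed

section \<open>The functionals as suprema of series potentials\<close>

lemma norm_mult_vec_Grass1:
  "P \<in> Grass1 cj \<Longrightarrow> (norm (P *v x))\<^sup>2 = P \<bullet> proj_line cj x"
  by (auto simp: Grass1_def norm_proj_line_mult_vec)

lemma proj_line_image_sphere: "proj_line cj ` sphere_H = Grass1 cj"
  by (auto simp: Grass1_def sphere_H_def)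

text \<open>The kernel \<open>(1 - t) powr s\<close> is 1 minus the power series kernel. The second
  claim ensures that \<open>enn2real\<close>, which sends infinity to 0, loses nothing here.\<close>

lemma F_pow_eq:
  fixes \<mu> :: "('f^'n^'n) measure"
  assumes \<mu>: "borel_prob_G cj \<mu>" and s: "0 < s" "s < 1"
  shows "F_pow s \<mu> = (SUP Q\<in>Grass1 cj. 1 - enn2real (series_potential (pow_coeff s) (push_borel \<mu>) Q))"
    and "Q \<in> Grass1 cj \<Longrightarrow> series_potential (pow_coeff s) (push_borel \<mu>) Q \<le> 1"
proof -
  interpret M: compactly_supported_prob "push_borel \<mu>" "Grass1 cj"
    by (rule compactly_supported_push_borel) fact
  note m = borel_prob_G_measurable[OF \<mu>]
  have pot: "series_potential (pow_coeff s) (push_borel \<mu>) Q = (\<integral>\<^sup>+P. ennreal (1 - (1 - P \<bullet> Q) powr s) \<partial>push_borel \<mu>)"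
    if "Q \<in> Grass1 cj" for Q
    unfolding series_potential_def
  proof (rule nn_integral_cong_AE)
    show "AE P in push_borel \<mu>. (\<Sum>k. ennreal (pow_coeff s k * (P \<bullet> Q) ^ k)) = ennreal (1 - (1 - P \<bullet> Q) powr s)"
      using M.AE_G by eventually_elim (rule suminf_pow_coeff[OF s inner_Grass1[OF _ that]])
  qed
  have bd: "AE P in push_borel \<mu>. 0 \<le> (1 - P \<bullet> Q) powr s \<and> (1 - P \<bullet> Q) powr s \<le> 1"
    if "Q \<in> Grass1 cj" for Q
    using M.AE_G by eventually_elim (use inner_Grass1[OF _ that] s in \<open>auto intro!: powr_le1\<close>)
  show "series_potential (pow_coeff s) (push_borel \<mu>) Q \<le> 1" if "Q \<in> Grass1 cj" for Q
  proof -
    have "series_potential (pow_coeff s) (push_borel \<mu>) Q \<le> (\<integral>\<^sup>+P. 1 \<partial>push_borel \<mu>)"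
      unfolding pot[OF that] by (intro nn_integral_mono) auto
    then show ?thesis by (simp add: M.emeasure_space_1)
  qed
  have "(\<integral>W. (1 - (norm (W *v x))\<^sup>2) powr s \<partial>\<mu>) =
      1 - enn2real (series_potential (pow_coeff s) (push_borel \<mu>) (proj_line cj x))"
    if "x \<in> sphere_H" for x
  proof -
    let ?Q = "proj_line cj x"
    have Q: "?Q \<in> Grass1 cj" using that proj_line_image_sphere by auto
    have "(\<integral>W. (1 - (norm (W *v x))\<^sup>2) powr s \<partial>\<mu>) = (\<integral>W. (1 - W \<bullet> ?Q) powr s \<partial>\<mu>)"
      by (intro Bochner_Integration.integral_cong) (auto simp: norm_mult_vec_Grass1 m)
    also have "\<dots> = (\<integral>P. (1 - P \<bullet> ?Q) powr s \<partial>push_borel \<mu>)"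
      unfolding push_borel_def by (rule integral_distr[symmetric]) (use m in simp_all)
    also have "\<dots> = 1 - (\<integral>P. 1 - (1 - P \<bullet> ?Q) powr s \<partial>push_borel \<mu>)"
    proof -
      have "integrable (push_borel \<mu>) (\<lambda>P. (1 - P \<bullet> ?Q) powr s)"
        using bd[OF Q] by (intro M.integrable_const_bound[of _ 1]) (auto elim!: eventually_mono)
      then show ?thesis by (simp add: M.prob_space)
    qed
    also have "(\<integral>P. 1 - (1 - P \<bullet> ?Q) powr s \<partial>push_borel \<mu>) =
        enn2real (series_potential (pow_coeff s) (push_borel \<mu>) ?Q)"
      unfolding pot[OF Q] using bd[OF Q]
      by (intro integral_eq_nn_integral) (auto elim!: eventually_mono)
    finally show ?thesis .
  qed
  then show "F_pow s \<mu> = (SUP Q\<in>Grass1 cj. 1 - enn2real (series_potential (pow_coeff s) (push_borel \<mu>) Q))"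
    unfolding F_pow_def by (simp add: image_image flip: proj_line_image_sphere cong: image_cong)
qed

lemma F_log_eq:
  fixes \<mu> :: "('f^'n^'n) measure"
  assumes \<mu>: "borel_prob_G cj \<mu>"
  shows "F_log \<mu> = (SUP Q\<in>Grass1 cj. - enn2ereal (series_potential log_coeff (push_borel \<mu>) Q))"
proof -
  interpret M: compactly_supported_prob "push_borel \<mu>" "Grass1 cj"
    by (rule compactly_supported_push_borel) fact
  have "(\<integral>\<^sup>+W. neglog1m ((norm (W *v x))\<^sup>2) \<partial>\<mu>) = series_potential log_coeff (push_borel \<mu>) (proj_line cj x)"
    if "x \<in> sphere_H" for x
  proof -
    let ?Q = "proj_line cj x"
    have Q: "?Q \<in> Grass1 cj" using that proj_line_image_sphere by auto
    have "(\<integral>\<^sup>+W. neglog1m ((norm (W *v x))\<^sup>2) \<partial>\<mu>) = (\<integral>\<^sup>+W. neglog1m (W \<bullet> ?Q) \<partial>\<mu>)"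
      by (intro nn_integral_cong) (auto simp: norm_mult_vec_Grass1 borel_prob_G_measurable[OF \<mu>])
    also have "\<dots> = (\<integral>\<^sup>+W. neglog1m (W \<bullet> ?Q) \<partial>push_borel \<mu>)"
      by (rule nn_integral_push_borel[OF \<mu>, symmetric]) simp
    also have "\<dots> = series_potential log_coeff (push_borel \<mu>) ?Q"
      unfolding series_potential_def
    proof (rule nn_integral_cong_AE)
      show "AE P in push_borel \<mu>. neglog1m (P \<bullet> ?Q) = (\<Sum>k. ennreal (log_coeff k * (P \<bullet> ?Q) ^ k))"
        using M.AE_G by eventually_elim (rule suminf_log_coeff[OF inner_Grass1[OF _ Q], symmetric])
    qed
    finally show ?thesis .
  qed
  then show ?thesis
    unfolding F_log_def by (simp add: image_image flip: proj_line_image_sphere cong: image_cong)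
qed

lemma Grass1_nonempty: "(Grass1 cj :: ('f^'n^'n) set) \<noteq> {}"
proof -
  obtain v :: "'f^'n" where "norm v = 1" using vector_choose_size[of 1] by auto
  then show ?thesis unfolding Grass1_def by blast
qed

section \<open>Comparison of a competitor with the invariant measure\<close>

lemma series_potential_const:
  assumes \<Gamma>: "invariant_G cj \<Gamma>" and a: "\<And>k. 0 \<le> a k" and PQ: "P \<in> Grass1 cj" "Q \<in> Grass1 cj"
  shows "series_potential a (push_borel \<Gamma>) P = series_potential a (push_borel \<Gamma>) Q"
proof -
  interpret isotropic_prob "push_borel \<Gamma>" "Grass1 cj" by (rule isotropic_push_borel) fact
  show ?thesis unfolding series_potential_def by (rule isotropic[OF PQ]) measurable
qed

lemma unique_minimizer_F_pow:
  fixes \<Gamma> :: "('f^'n^'n) measure"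
  assumes \<Gamma>: "invariant_G cj \<Gamma>" and s: "0 < s" "s < 1"
  shows "unique_minimizer cj (F_pow s) \<Gamma>"
proof (rule unique_minimizerI)
  show \<Gamma>b: "borel_prob_G cj \<Gamma>" using \<Gamma> by (simp add: invariant_G_def)
  fix \<mu> :: "('f^'n^'n) measure" assume \<mu>: "borel_prob_G cj \<mu>" and le: "F_pow s \<mu> \<le> F_pow s \<Gamma>"
  interpret isotropic_prob "push_borel \<Gamma>" "Grass1 cj" by (rule isotropic_push_borel) fact
  let ?pot = "\<lambda>\<mu>. series_potential (pow_coeff s) (push_borel \<mu>)"
  obtain Q0 :: "'f^'n^'n" where Q0: "Q0 \<in> Grass1 cj" using Grass1_nonempty by blast
  have "F_pow s \<Gamma> = (SUP Q\<in>(Grass1 cj :: ('f^'n^'n) set). 1 - enn2real (?pot \<Gamma> Q0))"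
    unfolding F_pow_eq(1)[OF \<Gamma>b s]
    by (rule SUP_cong) (simp_all add: series_potential_const[OF \<Gamma> pow_coeff_nonneg[OF s] _ Q0])
  then have F\<Gamma>: "F_pow s \<Gamma> = 1 - enn2real (?pot \<Gamma> Q0)"
    using Q0 by (subst (asm) SUP_const_nonempty[OF Q0]) simp
  have ge: "?pot \<Gamma> Q0 \<le> ?pot \<mu> Q" if Q: "Q \<in> Grass1 cj" for Q
  proof -
    \<comment> \<open>A real supremum bounds its members only for a bounded family; here 1 is an
      upper bound.\<close>
    have "1 - enn2real (?pot \<mu> Q) \<le> F_pow s \<mu>"
      unfolding F_pow_eq(1)[OF \<mu> s] by (rule cSUP_upper[OF Q]) (auto intro!: bdd_aboveI2[of _ _ 1])
    then have "enn2real (?pot \<Gamma> Q0) \<le> enn2real (?pot \<mu> Q)" using le F\<Gamma> by simp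
    moreover have "?pot \<mu> Q < \<top>" "?pot \<Gamma> Q0 < \<top>"
      using F_pow_eq(2)[OF \<mu> s Q] F_pow_eq(2)[OF \<Gamma>b s Q0] by (auto intro: le_less_trans)
    ultimately show ?thesis by (metis ennreal_enn2real ennreal_leI)
  qed
  have "push_borel \<mu> = push_borel \<Gamma>"
  proof (rule eq_if_series_potential_ge[OF compactly_supported_push_borel[OF \<mu>] pow_coeff_nonneg[OF s] pow_coeff_pos[OF s] Q0 _ ge])
    show "?pot \<Gamma> Q0 < \<infinity>" using F_pow_eq(2)[OF \<Gamma>b s Q0] by (auto intro: le_less_trans)
  qed
  then show "\<mu> = \<Gamma>" by (rule push_borel_inject[OF \<mu> \<Gamma>b])
qed

lemma unique_minimizer_F_log:
  fixes \<Gamma> :: "('f^'n^'n) measure"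
  assumes \<Gamma>: "invariant_G cj \<Gamma>" and card: "CARD('n) \<ge> 2"
  shows "unique_minimizer cj F_log \<Gamma>"
proof (rule unique_minimizerI)
  show \<Gamma>b: "borel_prob_G cj \<Gamma>" using \<Gamma> by (simp add: invariant_G_def)
  fix \<mu> :: "('f^'n^'n) measure" assume \<mu>: "borel_prob_G cj \<mu>" and le: "F_log \<mu> \<le> F_log \<Gamma>"
  interpret isotropic_prob "push_borel \<Gamma>" "Grass1 cj" by (rule isotropic_push_borel) fact
  let ?pot = "\<lambda>\<mu>. series_potential log_coeff (push_borel \<mu>)"
  have nonneg: "0 \<le> log_coeff k" for k by (simp add: log_coeff_def)
  obtain Q0 :: "'f^'n^'n" where Q0: "Q0 \<in> Grass1 cj" using Grass1_nonempty by blast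
  have "F_log \<Gamma> = (SUP Q\<in>(Grass1 cj :: ('f^'n^'n) set). - enn2ereal (?pot \<Gamma> Q0))"
    unfolding F_log_eq[OF \<Gamma>b]
    by (rule SUP_cong) (simp_all add: series_potential_const[OF \<Gamma> nonneg _ Q0])
  then have F\<Gamma>: "F_log \<Gamma> = - enn2ereal (?pot \<Gamma> Q0)"
    using Q0 by (subst (asm) SUP_const_nonempty[OF Q0]) simp
  have ge: "?pot \<Gamma> Q0 \<le> ?pot \<mu> Q" if Q: "Q \<in> Grass1 cj" for Q
  proof -
    have "- enn2ereal (?pot \<mu> Q) \<le> F_log \<mu>"
      unfolding F_log_eq[OF \<mu>] by (rule SUP_upper[OF Q])
    also note le
    finally show ?thesis by (simp add: F\<Gamma> less_eq_ennreal.rep_eq)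
  qed
  \<comment> \<open>The dimension assumption enters here: it supplies the curve for the packing
    bound, which makes the constant potential of \<open>\<Gamma>\<close> finite.\<close>
  obtain q :: "real \<Rightarrow> 'f^'n^'n" where q: "\<And>t. 0 \<le> t \<Longrightarrow> t \<le> 1 \<Longrightarrow> q t \<in> Grass1 cj"
    "\<And>s t. 0 \<le> s \<Longrightarrow> 0 \<le> t \<Longrightarrow> \<bar>s - t\<bar> \<le> dist (q s) (q t)"
    using Grass1_separated[OF card] by blast
  have "?pot \<Gamma> Q0 = (\<integral>\<^sup>+P. neglog1m (P \<bullet> Q0) \<partial>push_borel \<Gamma>)"
    unfolding series_potential_def
  proof (rule nn_integral_cong_AE)
    show "AE P in push_borel \<Gamma>. (\<Sum>k. ennreal (log_coeff k * (P \<bullet> Q0) ^ k)) = neglog1m (P \<bullet> Q0)"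
      using AE_G by eventually_elim (rule suminf_log_coeff[OF inner_Grass1[OF _ Q0]])
  qed
  then have fin: "?pot \<Gamma> Q0 < \<infinity>"
    using nn_integral_neglog1m_finite[OF q Q0] by simp
  have "push_borel \<mu> = push_borel \<Gamma>"
    by (rule eq_if_series_potential_ge[OF compactly_supported_push_borel[OF \<mu>] nonneg _ Q0 fin ge])
      (simp add: log_coeff_def)
  then show "\<mu> = \<Gamma>" by (rule push_borel_inject[OF \<mu> \<Gamma>b])
qed

end

theorem theorem5p1:
  assumes "CARD('n::finite) \<ge> 2"
  shows "(\<forall>\<Gamma> :: (real^'n^'n) measure. invariant_G id \<Gamma> \<longrightarrow>
            (\<forall>s. 0 < s \<and> s < 1 \<longrightarrow> unique_minimizer id (F_pow s) \<Gamma>) \<and>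
            unique_minimizer id F_log \<Gamma>)
       \<and> (\<forall>\<Gamma> :: (complex^'n^'n) measure. invariant_G cnj \<Gamma> \<longrightarrow>
            (\<forall>s. 0 < s \<and> s < 1 \<longrightarrow> unique_minimizer cnj (F_pow s) \<Gamma>) \<and>
            unique_minimizer cnj F_log \<Gamma>)"
proof (intro conjI allI impI; (elim conjE)?)
  fix \<Gamma> :: "(real^'n^'n) measure" and s :: real
  assume "invariant_G id \<Gamma>"
  then show "unique_minimizer id F_log \<Gamma>"
    using assms by (rule conj_field.unique_minimizer_F_log[OF conj_field_id])
  assume "0 < s" "s < 1"
  with \<open>invariant_G id \<Gamma>\<close> show "unique_minimizer id (F_pow s) \<Gamma>"
    by (rule conj_field.unique_minimizer_F_pow[OF conj_field_id])
next
  fix \<Gamma> :: "(complex^'n^'n) measure" and s :: real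
  assume "invariant_G cnj \<Gamma>"
  then show "unique_minimizer cnj F_log \<Gamma>"
    using assms by (rule conj_field.unique_minimizer_F_log[OF conj_field_cnj])
  assume "0 < s" "s < 1"
  with \<open>invariant_G cnj \<Gamma>\<close> show "unique_minimizer cnj (F_pow s) \<Gamma>"
    by (rule conj_field.unique_minimizer_F_pow[OF conj_field_cnj])
qed

end
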